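(* Let $(f_n)_{n\ge 0}$ be independent identically distributed complex Gaussian random variables with expectation $0$ and variance $1$, let $\mathfrak{f}_{\mathbb{D}}(z)=\sum_{n=0}^\infty f_n z^n$, and let $Z(\mathfrak{f}_{\mathbb{D}})=\{z\in\mathbb{D}:\mathfrak{f}_{\mathbb{D}}(z)=0\}$. Then, almost surely, $Z(\mathfrak{f}_{\mathbb{D}})$ is neither $A^2(\mathbb{D})$-sampling nor $A^2(\mathbb{D})$-interpolating.
   Context: $\mathbb{D}$ is the open unit disc in $\mathbb{C}$. Complex Gaussian with expectation $0$ and variance $1$ means the standard (circularly symmetric) complex Gaussian with $\mathbb{E}|f_n|^2=1$; the series has radius of convergence $1$ almost surely. $A^2(\mathbb{D})$ is the Bergman space of holomorphic functions on $\mathbb{D}$ that are square-integrable with respect to Lebesgue measure. A discrete subset $Z\subset\mathbb{D}$ is $A^2(\mathbb{D})$-sampling if there are constants $C_1,C_2>0$ such that for all $g\in A^2(\mathbb{D})$, $$C_1\|g\|_{A^2(\mathbb{D})}^2\le\sum_{z\in Z}|g(z)|^2(1-|z|^2)^2\le C_2\|g\|_{A^2(\mathbb{D})}^2.$$ A discrete subset $Z=\{z_1,z_2,\dots\}\subset\mathbb{D}$ is $A^2(\mathbb{D})$-interpolating if for every complex sequence $(a_j)$ with $(a_j(1-|z_j|^2))_j\in\ell^2$ there is $g\in A^2(\mathbb{D})$ with $g(z_j)=a_j$ for all $j$. *)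

theory Defs
  imports "HOL-Probability.Probability" "HOL-Complex_Analysis.Complex_Analysis"
begin

text \<open>
  Circularly symmetric complex Gaussian with mean 0 and \<open>\<E>|X|\<^sup>2 = 1\<close> (so the real and
  imaginary parts have variance 1/2 each), given by its density with respect to planar
  Lebesgue measure.
\<close>

definition std_complex_gaussian :: "'a measure \<Rightarrow> ('a \<Rightarrow> complex) \<Rightarrow> bool" where
  "std_complex_gaussian M X \<longleftrightarrow>
     distributed M lborel X (\<lambda>z. ennreal (exp (- (cmod z)\<^sup>2) / pi))"

definition gaf_disc :: "(nat \<Rightarrow> complex) \<Rightarrow> complex \<Rightarrow> complex" where
  "gaf_disc c z = (\<Sum>n. c n * z ^ n)"

definition gaf_zeros :: "(nat \<Rightarrow> complex) \<Rightarrow> complex set" where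
  "gaf_zeros c = {z \<in> ball 0 1. gaf_disc c z = 0}"

text \<open>
  Elements of the Bergman space are represented by total functions; only their values on the
  disc are relevant.
\<close>

definition bergman_space :: "(complex \<Rightarrow> complex) set" where
  "bergman_space = {g. g holomorphic_on ball 0 1 \<and>
     set_integrable lborel (ball 0 1) (\<lambda>z. (cmod (g z))\<^sup>2)}"

definition bergman_norm :: "(complex \<Rightarrow> complex) \<Rightarrow> real" where
  "bergman_norm g = sqrt (LINT z:ball 0 1|lborel. (cmod (g z))\<^sup>2)"

text \<open>
  Discreteness of \<open>Z\<close> (the constant is qualified because the probability library hides it
  behind a type of the same name) is a standing assumption in the next two definitions.
  It does not make their negations any weaker: for \<open>Z\<close> in the disc, the remaining clauses
  already exclude accumulation points of \<open>Z\<close> inside the disc (for sampling, use \<open>g = 1\<close>;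
  for interpolation, prescribe 1 at one point of \<open>Z\<close> and 0 at all others).
  Summability is required explicitly because \<^const>\<open>infsum\<close> is 0 on divergent real sums.
\<close>

definition bergman_sampling :: "complex set \<Rightarrow> bool" where
  "bergman_sampling Z \<longleftrightarrow> Z \<subseteq> ball 0 1 \<and> topological_space_class.discrete Z \<and>
     (\<exists>C1>0. \<exists>C2>0. \<forall>g\<in>bergman_space.
        (\<lambda>z. (cmod (g z))\<^sup>2 * (1 - (cmod z)\<^sup>2)\<^sup>2) summable_on Z \<and>
        C1 * (bergman_norm g)\<^sup>2 \<le> (\<Sum>\<^sub>\<infinity>z\<in>Z. (cmod (g z))\<^sup>2 * (1 - (cmod z)\<^sup>2)\<^sup>2) \<and>
        (\<Sum>\<^sub>\<infinity>z\<in>Z. (cmod (g z))\<^sup>2 * (1 - (cmod z)\<^sup>2)\<^sup>2) \<le> C2 * (bergman_norm g)\<^sup>2)"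

text \<open>The data to be interpolated are indexed by the points of \<open>Z\<close> instead of by an enumeration.\<close>

definition bergman_interpolating :: "complex set \<Rightarrow> bool" where
  "bergman_interpolating Z \<longleftrightarrow> Z \<subseteq> ball 0 1 \<and> topological_space_class.discrete Z \<and>
     (\<forall>a :: complex \<Rightarrow> complex.
        (\<lambda>z. (cmod (a z * of_real (1 - (cmod z)\<^sup>2)))\<^sup>2) summable_on Z \<longrightarrow>
        (\<exists>g\<in>bergman_space. \<forall>z\<in>Z. g z = a z))"

end

theory Submission imports Defs begin

text \<open>
  The random zero set contains, almost surely and for every \<open>N\<close>, \<open>N\<close> distinct points in a disc
  of radius \<open>(1 - \<rho>) / N\<close> around some \<open>\<rho> \<in> (0, 1)\<close>. Such clusters refute both properties: the normalised
  kernel function at \<open>\<rho>\<close> has norm of order 1 but square sum at least of order \<open>N\<close> over the zeros, and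
  interpolating \<open>2\<^sup>-\<^sup>k\<close> (in the weighted normalisation) and \<open>0\<close> at two zeros of hyperbolic
  distance \<open>4\<^sup>-\<^sup>k\<close> contradicts the Lipschitz estimate for a Bergman function.

  To find a cluster, look at \<open>z = exp (- s / M)\<close> with \<open>s\<close> near 1. Abel summation bounds the series there by
  \<open>\<bar>1 - z\<bar> \<Sum>\<^sub>n \<bar>f\<^sub>0 + \<dots> + f\<^sub>n\<bar> exp (- n / (2 M))\<close>, where the sum over \<open>n\<close> has expectation of
  order \<open>M\<^sup>3\<^sup>/\<^sup>2\<close>. The deterministic series with coefficients
  \<open>P\<^sub>i / \<surd>M\<close> on the block \<open>i M \<le> k < (i + 1) M\<close> equals
  \<open>P (e\<^sup>-\<^sup>s) (1 - e\<^sup>-\<^sup>s) / (\<surd>M (1 - z))\<close>, so for a suitable multiple \<open>P\<close> of a polynomial with \<open>N\<close> simple zeros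
  it dominates uniformly in \<open>M\<close>. Its coefficients have an \<open>\<ell>\<^sup>2\<close> norm independent of \<open>M\<close>, hence by the Cameron-Martin
  formula \<open>f\<close> minus this sequence is small at scale \<open>M\<close> with a probability bounded below; smallness for
  infinitely many \<open>M\<close> is a tail event, so Kolmogorov's law makes it almost sure.
\<close>

subsection \<open>Point evaluations on the Bergman space\<close>

lemma borel_measurable_Complex [measurable (raw)]:
  assumes "g \<in> borel_measurable M" "h \<in> borel_measurable M"
  shows "(\<lambda>p. Complex (g p) (h p)) \<in> borel_measurable M"
  using assms unfolding Complex_eq by measurable

lemma lborel_complex_eq_distr:
  "(lborel :: complex measure) = distr (lborel \<Otimes>\<^sub>M lborel) borel (\<lambda>p. Complex (fst p) (snd p))"
proof (rule lborel_eqI)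
  fix l u :: complex
  assume le: "\<And>b. b \<in> Basis \<Longrightarrow> l \<bullet> b \<le> u \<bullet> b"
  from le[of 1] le[of \<i>] have lu: "Re l \<le> Re u" "Im l \<le> Im u" by auto
  have *: "(\<lambda>p. Complex (fst p) (snd p)) -` box l u \<inter> space (lborel \<Otimes>\<^sub>M lborel)
      = {Re l<..<Re u} \<times> {Im l<..<Im u}"
    by (auto simp: in_box_complex_iff space_pair_measure)
  have "emeasure (distr (lborel \<Otimes>\<^sub>M lborel) borel (\<lambda>p. Complex (fst p) (snd p))) (box l u)
     = emeasure (lborel \<Otimes>\<^sub>M lborel) ({Re l<..<Re u} \<times> {Im l<..<Im u})"
    by (subst emeasure_distr) (auto simp: *)
  also have "\<dots> = ennreal (Re u - Re l) * ennreal (Im u - Im l)"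
    using lu by (subst lborel.emeasure_pair_measure_Times) auto
  also have "\<dots> = ennreal ((Re u - Re l) * (Im u - Im l))"
    using lu by (simp add: ennreal_mult)
  finally show "emeasure (distr (lborel \<Otimes>\<^sub>M lborel) borel (\<lambda>p. Complex (fst p) (snd p))) (box l u)
     = (\<Prod>b\<in>Basis. (u - l) \<bullet> b)"
    by (simp add: Basis_complex_def)
qed simp

lemma nn_integral_lborel_complex:
  fixes f :: "complex \<Rightarrow> ennreal"
  assumes [measurable]: "f \<in> borel_measurable borel"
  shows "(\<integral>\<^sup>+z. f z \<partial>lborel) = (\<integral>\<^sup>+x. \<integral>\<^sup>+y. f (Complex x y) \<partial>lborel \<partial>lborel)"
proof -
  show ?thesis
    by (subst lborel_complex_eq_distr, subst nn_integral_distr)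
      (simp_all add: lborel.nn_integral_fst[symmetric])
qed

text \<open>By Fubini a rotation splits into two one-dimensional affine substitutions, first in x
  and then in y, whose Jacobian factors cancel. This works if \<open>Re u\<close> is nonzero; a
  purely imaginary \<open>u\<close> is handled as two rotations by its square root.\<close>

lemma nn_integral_lborel_complex_rotate:
  fixes f :: "complex \<Rightarrow> ennreal"
  assumes f[measurable]: "f \<in> borel_measurable borel" and u: "norm u = 1"
  shows "(\<integral>\<^sup>+z. f (u * z) \<partial>lborel) = (\<integral>\<^sup>+z. f z \<partial>lborel)"
proof -
  have *: "(\<integral>\<^sup>+z. f (u * z) \<partial>lborel) = (\<integral>\<^sup>+z. f z \<partial>lborel)"
    if f[measurable]: "f \<in> borel_measurable borel" and u: "norm u = 1" and a: "Re u \<noteq> 0"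
    for u and f :: "complex \<Rightarrow> ennreal"
  proof -
    define a b where "a = Re u" and "b = Im u"
    have ab: "a\<^sup>2 + b\<^sup>2 = 1" using u by (simp add: a_def b_def cmod_def)
    have a0: "a \<noteq> 0" using a by (simp add: a_def)
    have uz: "u * Complex x y = Complex (a * x - b * y) (b * x + a * y)" for x y
      by (simp add: a_def b_def complex_eq_iff)
    \<comment> \<open>For fixed \<open>y\<close> the new variable is x' = a x - b y; the second
      coordinate becomes (b x' + y) / a because the squares of \<open>a\<close> and \<open>b\<close>
      add up to 1.\<close>
    have e1: "(\<integral>\<^sup>+x. f (Complex (a * x - b * y) (b * x + a * y)) \<partial>lborel)
        = \<bar>1/a\<bar> * (\<integral>\<^sup>+x. f (Complex x ((b * x + y) / a)) \<partial>lborel)" for y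
    proof -
      have eq: "b * ((b*y)/a + (1/a) * x) + a * y = (b * x + y) / a" for x
      proof -
        have "b * ((b*y)/a + (1/a) * x) + a * y = (b * x + (a\<^sup>2 + b\<^sup>2) * y) / a"
          using a0 by (simp add: field_simps power2_eq_square)
        then show ?thesis using ab by simp
      qed
      have eq': "a * ((b*y)/a + (1/a) * x) - b * y = x" for x
        using a0 by (simp add: field_simps)
      show ?thesis
        by (subst nn_integral_real_affine[where c="1/a" and t="b*y/a"])
           (use a0 in \<open>simp_all only: eq eq'\<close>, simp_all)
    qed
    have e2: "(\<integral>\<^sup>+y. f (Complex x y) \<partial>lborel)
        = \<bar>1/a\<bar> * (\<integral>\<^sup>+y. f (Complex x ((b * x + y) / a)) \<partial>lborel)" for x
      by (subst nn_integral_real_affine[where c="1/a" and t="b*x/a"])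
         (use a0 in \<open>simp_all add: field_simps\<close>)
    have "(\<integral>\<^sup>+z. f (u * z) \<partial>lborel) =
       (\<integral>\<^sup>+x. \<integral>\<^sup>+y. f (Complex (a * x - b * y) (b * x + a * y)) \<partial>lborel \<partial>lborel)"
      by (subst nn_integral_lborel_complex) (simp_all only: uz, simp_all)
    also have "\<dots> = (\<integral>\<^sup>+y. \<integral>\<^sup>+x. f (Complex (a * x - b * y) (b * x + a * y)) \<partial>lborel \<partial>lborel)"
      by (rule lborel_pair.Fubini'[symmetric]) simp
    also have "\<dots> = (\<integral>\<^sup>+y. \<bar>1/a\<bar> * (\<integral>\<^sup>+x. f (Complex x ((b * x + y) / a)) \<partial>lborel) \<partial>lborel)"
      by (simp only: e1)
    also have "\<dots> = \<bar>1/a\<bar> * (\<integral>\<^sup>+y. (\<integral>\<^sup>+x. f (Complex x ((b * x + y) / a)) \<partial>lborel) \<partial>lborel)"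
      by (rule nn_integral_cmult) measurable
    also have "\<dots> = \<bar>1/a\<bar> * (\<integral>\<^sup>+x. (\<integral>\<^sup>+y. f (Complex x ((b * x + y) / a)) \<partial>lborel) \<partial>lborel)"
      by (subst lborel_pair.Fubini') simp_all
    also have "\<dots> = (\<integral>\<^sup>+x. \<bar>1/a\<bar> * (\<integral>\<^sup>+y. f (Complex x ((b * x + y) / a)) \<partial>lborel) \<partial>lborel)"
      by (rule nn_integral_cmult[symmetric]) measurable
    also have "\<dots> = (\<integral>\<^sup>+x. \<integral>\<^sup>+y. f (Complex x y) \<partial>lborel \<partial>lborel)"
      by (simp only: e2)
    also have "\<dots> = (\<integral>\<^sup>+z. f z \<partial>lborel)"
      by (rule nn_integral_lborel_complex[symmetric]) simp
    finally show ?thesis .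
  qed
  show ?thesis
  proof (cases "Re u = 0")
    case True
    \<comment> \<open>If \<open>Re v\<close> were 0, then \<open>v * v\<close> would be -1, which
      has nonzero real part, unlike \<open>u\<close>.\<close>
    define v where "v = csqrt u"
    have v: "v * v = u" by (simp add: v_def flip: power2_eq_square)
    have nv: "norm v = 1"
      using u unfolding v_def by (simp)
    have rv: "Re v \<noteq> 0"
    proof
      assume "Re v = 0"
      then have "(Im v)\<^sup>2 = 1" using nv cmod_power2[of v] \<open>Re v = 0\<close> by simp
      then have "Re (v * v) = -1" using \<open>Re v = 0\<close> by (simp add: power2_eq_square)
      with v True show False by simp
    qed
    have "(\<integral>\<^sup>+z. f (u * z) \<partial>lborel) = (\<integral>\<^sup>+z. f (v * (v * z)) \<partial>lborel)"
      by (simp flip: v add: mult.assoc)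
    also have "\<dots> = (\<integral>\<^sup>+z. f (v * z) \<partial>lborel)"
      using *[of "\<lambda>z. f (v * z)" v] nv rv by simp
    also have "\<dots> = (\<integral>\<^sup>+z. f z \<partial>lborel)" using *[of f v] nv rv by simp
    finally show ?thesis .
  qed (use * u f in auto)
qed

text \<open>The mean value property: Cauchy's formula at the centre, parametrised by
  \<open>cis\<close>, makes \<open>f 0\<close> the average of \<open>f\<close> over the unit circle,
  and the norm is then taken inside the integral.\<close>

lemma norm_le_nn_integral_circle:
  assumes hol: "f holomorphic_on ball 0 1" and cont: "continuous_on (cball 0 1) f"
  shows "ennreal (2 * pi * norm (f 0)) \<le> (\<integral>\<^sup>+t\<in>{0..2*pi}. ennreal (norm (f (cis t))) \<partial>lborel)"
proof -
  have "((\<lambda>u. f u / (u - 0)) has_contour_integral (2 * of_real pi * \<i> * f 0)) (circlepath 0 1)"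
    by (rule Cauchy_integral_circlepath) (use assms in auto)
  then have "((\<lambda>t. f (cis t) / cis t * \<i> * cis t) has_integral (2 * of_real pi * \<i> * f 0)) {0..2*pi}"
    unfolding circlepath_def by (subst (asm) has_contour_integral_part_circlepath_iff) auto
  then have *: "((\<lambda>t. \<i> * f (cis t)) has_integral (2 * of_real pi * \<i> * f 0)) {0..2*pi}"
    by (simp add: field_simps)
  have c: "continuous_on {0..2*pi} (\<lambda>t. \<i> * f (cis t))"
    by (intro continuous_intros continuous_on_compose2[OF cont]) auto
  have i: "set_integrable lborel {0..2*pi} (\<lambda>t. \<i> * f (cis t))"
    unfolding set_integrable_def by (rule borel_integrable_atLeastAtMost'[OF c, unfolded set_integrable_def])
  have "2 * of_real pi * \<i> * f 0 = (LINT t:{0..2*pi}|lborel. \<i> * f (cis t))"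
    unfolding set_borel_integral_eq_integral(2)[OF i] using * by (rule integral_unique[symmetric])
  also have "norm \<dots> \<le> (\<integral>\<^sup>+t. norm (indicator {0..2*pi} t *\<^sub>R (\<i> * f (cis t))) \<partial>lborel)"
    unfolding set_lebesgue_integral_def
    by (rule integral_norm_bound_ennreal) (use i in \<open>simp add: set_integrable_def\<close>)
  also have "\<dots> = (\<integral>\<^sup>+t\<in>{0..2*pi}. ennreal (norm (f (cis t))) \<partial>lborel)"
    by (intro nn_integral_cong) (auto split: split_indicator simp: norm_mult)
  finally show ?thesis by (simp add: norm_mult)
qed

text \<open>Averaging the circle estimate over all \<open>w\<close> in the disc replaces polar coordinates: rotation
  invariance makes the inner integral independent of the angle.\<close>

lemma norm_le_nn_integral_ball:
  fixes h :: "complex \<Rightarrow> complex"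
  assumes hol: "h holomorphic_on ball v R" and R: "R > 0"
  shows "ennreal (pi * R\<^sup>2 * norm (h v)) \<le> (\<integral>\<^sup>+z\<in>ball v R. ennreal (norm (h z)) \<partial>lborel)"
proof -
  \<comment> \<open>Off the ball the values of \<open>h\<close> are arbitrary. Cutting off by 0
    gives a function measurable on the whole plane, to which translation and rotation invariance
    apply.\<close>
  define H where "H z = ennreal (indicator (ball v R) z *\<^sub>R norm (h z))" for z
  have "(\<lambda>z. indicator (ball v R) z *\<^sub>R norm (h z)) \<in> borel_measurable borel"
    by (intro borel_measurable_continuous_on_indicator continuous_intros)
       (use hol holomorphic_on_imp_continuous_on in auto)
  then have [measurable]: "H \<in> borel_measurable borel"
    unfolding H_def by (rule measurable_compose[OF _ measurable_ennreal])
  have [measurable]: "cis \<in> borel_measurable borel"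
    by (intro borel_measurable_continuous_onI continuous_intros)
  have shift: "(\<integral>\<^sup>+w. H (v + w) \<partial>lborel) = (\<integral>\<^sup>+z. H z \<partial>lborel)"
    by (subst (2) lborel_distr_plus[symmetric, of v], subst nn_integral_distr) simp_all
  have pt: "ennreal (2 * pi * norm (h v)) * indicator (ball 0 R) w
      \<le> (\<integral>\<^sup>+t\<in>{0..2*pi}. H (v + cis t * w) \<partial>lborel)" for w
  proof (cases "w \<in> ball 0 R")
    case True
    have sub: "v + z * w \<in> ball v R" if "z \<in> cball 0 1" for z
    proof -
      have "norm (z * w) \<le> 1 * norm w" unfolding norm_mult using that by (intro mult_right_mono) auto
      then show ?thesis using True by (simp add: dist_norm norm_minus_commute)
    qed
    have "ennreal (2 * pi * norm (h (v + 0 * w))) \<le>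
        (\<integral>\<^sup>+t\<in>{0..2*pi}. ennreal (norm (h (v + cis t * w))) \<partial>lborel)"
    proof (rule norm_le_nn_integral_circle)
      show "(\<lambda>z. h (v + z * w)) holomorphic_on ball 0 1"
        by (rule holomorphic_on_compose_gen[OF _ hol, unfolded o_def])
           (use sub in \<open>auto intro!: holomorphic_intros\<close>)
      show "continuous_on (cball 0 1) (\<lambda>z. h (v + z * w))"
        by (rule continuous_on_compose2[OF holomorphic_on_imp_continuous_on[OF hol]])
           (use sub in \<open>auto intro!: continuous_intros\<close>)
    qed
    also have "\<dots> = (\<integral>\<^sup>+t\<in>{0..2*pi}. H (v + cis t * w) \<partial>lborel)"
      unfolding H_def using sub by (intro nn_integral_cong) (auto split: split_indicator)
    finally show ?thesis using True by simp
  qed simp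
  have "ennreal (2 * pi * norm (h v)) * ennreal (pi * R\<^sup>2) =
     (\<integral>\<^sup>+w. ennreal (2 * pi * norm (h v)) * indicator (ball 0 R) (w::complex) \<partial>lborel)"
    using R by (simp add: nn_integral_cmult_indicator emeasure_ball unit_ball_vol_2)
  also have "\<dots> \<le> (\<integral>\<^sup>+w. \<integral>\<^sup>+t. H (v + cis t * w) * indicator {0..2*pi} t \<partial>lborel \<partial>lborel)"
    by (intro nn_integral_mono pt)
  also have "\<dots> = (\<integral>\<^sup>+t. \<integral>\<^sup>+w. H (v + cis t * w) * indicator {0..2*pi} t \<partial>lborel \<partial>lborel)"
    by (intro lborel_pair.Fubini'[symmetric]) simp
  also have "\<dots> = (\<integral>\<^sup>+t. (\<integral>\<^sup>+w. H (v + cis t * w) \<partial>lborel) * indicator {0..2*pi} t \<partial>lborel)"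
    by (intro nn_integral_cong nn_integral_multc) simp
  also have "\<dots> = (\<integral>\<^sup>+t. (\<integral>\<^sup>+z. H z \<partial>lborel) * indicator {0..2*pi} t \<partial>lborel)"
    by (subst nn_integral_lborel_complex_rotate[where f="\<lambda>w. H (v + w)"]) (simp_all add: shift)
  also have "\<dots> = ennreal (2 * pi) * (\<integral>\<^sup>+z. H z \<partial>lborel)"
    by (subst nn_integral_cmult) (auto simp: mult.commute)
  finally have "ennreal (2 * pi) * ennreal (pi * R\<^sup>2 * norm (h v)) \<le> ennreal (2 * pi) * (\<integral>\<^sup>+z. H z \<partial>lborel)"
    by (simp add: mult_ac flip: ennreal_mult)
  then have "ennreal (pi * R\<^sup>2 * norm (h v)) \<le> (\<integral>\<^sup>+z. H z \<partial>lborel)"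
    by (subst (asm) ennreal_mult_le_mult_iff) auto
  also have "(\<integral>\<^sup>+z. H z \<partial>lborel) = (\<integral>\<^sup>+z\<in>ball v R. ennreal (norm (h z)) \<partial>lborel)"
    unfolding H_def by (intro nn_integral_cong) (auto split: split_indicator)
  finally show ?thesis .
qed

section \<open>The Bergman norm as an area integral and its control of point values\<close>

lemma bergman_norm_nonneg: "bergman_norm g \<ge> 0"
  unfolding bergman_norm_def set_lebesgue_integral_def
  by (intro real_sqrt_ge_zero integral_nonneg_AE) (auto simp: indicator_def)

lemma bergman_norm_power2:
  assumes "g \<in> bergman_space"
  shows "ennreal ((bergman_norm g)\<^sup>2) = (\<integral>\<^sup>+z\<in>ball 0 1. ennreal ((cmod (g z))\<^sup>2) \<partial>lborel)"
proof -
  have "(bergman_norm g)\<^sup>2 = (LINT z:ball 0 1|lborel. (cmod (g z))\<^sup>2)"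
    unfolding bergman_norm_def set_lebesgue_integral_def
    by (subst real_sqrt_pow2) (auto intro!: integral_nonneg)
  also have "ennreal \<dots> = (\<integral>\<^sup>+z. ennreal (indicator (ball 0 1) z *\<^sub>R (cmod (g z))\<^sup>2) \<partial>lborel)"
    unfolding set_lebesgue_integral_def
    by (subst nn_integral_eq_integral)
      (use assms in \<open>auto simp: bergman_space_def set_integrable_def\<close>)
  also have "\<dots> = (\<integral>\<^sup>+z\<in>ball 0 1. ennreal ((cmod (g z))\<^sup>2) \<partial>lborel)"
    by (intro nn_integral_cong) (auto split: split_indicator)
  finally show ?thesis .
qed

text \<open>The area estimate is applied to the holomorphic function \<open>g\<close> squared, whose
  norm is the integrand of the Bergman norm.\<close>

lemma bergman_pointwise_bound:
  assumes g: "g \<in> bergman_space" and sub: "ball v r \<subseteq> ball 0 1" and r: "r > 0"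
  shows "pi * r\<^sup>2 * (cmod (g v))\<^sup>2 \<le> (bergman_norm g)\<^sup>2"
proof -
  have "ennreal (pi * r\<^sup>2 * cmod ((g v)\<^sup>2)) \<le> (\<integral>\<^sup>+z\<in>ball v r. ennreal (cmod ((g z)\<^sup>2)) \<partial>lborel)"
    by (rule norm_le_nn_integral_ball)
       (use g r sub in \<open>auto simp: bergman_space_def intro!: holomorphic_intros intro: holomorphic_on_subset\<close>)
  also have "\<dots> \<le> (\<integral>\<^sup>+z\<in>ball 0 1. ennreal ((cmod (g z))\<^sup>2) \<partial>lborel)"
    using sub by (intro nn_integral_mono) (auto split: split_indicator simp: norm_power)
  also have "\<dots> = ennreal ((bergman_norm g)\<^sup>2)" using bergman_norm_power2[OF g] by simp
  finally show ?thesis by (simp add: norm_power)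
qed

subsection \<open>Clustered sets are neither sampling nor interpolating\<close>

text \<open>The radius is the fraction 1/N of the distance from \<open>\<rho>\<close> to the unit
  circle, so the points have mutual hyperbolic distance of order 1/N. The number of points
  contradicts sampling, their closeness contradicts interpolation.\<close>

definition clustered :: "complex set \<Rightarrow> bool" where
  "clustered Z \<longleftrightarrow> (\<forall>N::nat. N > 0 \<longrightarrow> (\<exists>\<rho>\<in>{0<..<1}. \<exists>S. finite S \<and> card S = N \<and>
     S \<subseteq> Z \<inter> ball (of_real \<rho>) ((1 - \<rho>) / N)))"

lemma one_minus_norm_bounds:
  assumes \<rho>: "\<rho> \<in> {0<..<1}" and z: "z \<in> ball (complex_of_real \<rho>) ((1 - \<rho>) / 2)"
  shows "norm z < 1" "(1 - \<rho>) / 2 \<le> 1 - (norm z)\<^sup>2" "1 - (norm z)\<^sup>2 \<le> 3 * (1 - \<rho>)"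
proof -
  have d: "norm (z - complex_of_real \<rho>) < (1 - \<rho>) / 2"
    using z by (simp only: mem_ball dist_norm norm_minus_commute)
  have r: "norm (complex_of_real \<rho>) = \<rho>" using \<rho> by simp
  have "norm z \<le> norm (complex_of_real \<rho>) + norm (z - complex_of_real \<rho>)" by norm
  then have 1: "norm z < \<rho> + (1 - \<rho>) / 2" using d r by linarith
  have "norm (complex_of_real \<rho>) \<le> norm z + norm (z - complex_of_real \<rho>)" by norm
  then have 2: "norm z > \<rho> - (1 - \<rho>) / 2" using d r by linarith
  show n: "norm z < 1" using 1 \<rho> by (simp add: field_simps)
  have "(norm z)\<^sup>2 \<le> norm z" using n by (simp add: power2_eq_square mult_left_le)
  then show "(1 - \<rho>) / 2 \<le> 1 - (norm z)\<^sup>2" using 1 by (simp add: field_simps)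
  have "1 - (norm z)\<^sup>2 = (1 - norm z) * (1 + norm z)" by (simp add: algebra_simps power2_eq_square)
  also have "\<dots> \<le> (1 - norm z) * 2" using n by (intro mult_left_mono) auto
  also have "\<dots> \<le> 3 * (1 - \<rho>)" using 2 by (simp add: field_simps)
  finally show "1 - (norm z)\<^sup>2 \<le> 3 * (1 - \<rho>)" .
qed

text \<open>With \<delta> = 1 - \<rho>, point evaluation on balls of radius \<delta>/4 bounds
  \<open>g\<close> by 4/\<delta> times its norm up to distance 3\<delta>/4 from
  \<open>\<rho>\<close>. Cauchy's inequality on circles of radius \<delta>/8 then bounds the
  derivative on the ball of radius \<delta>/2, which is convex.\<close>

lemma bergman_lipschitz:
  assumes g: "g \<in> bergman_space" and \<rho>: "\<rho> \<in> {0<..<1}"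
    and z: "z \<in> ball (of_real \<rho>) ((1 - \<rho>) / 2)" and w: "w \<in> ball (of_real \<rho>) ((1 - \<rho>) / 2)"
  shows "norm (g z - g w) \<le> 32 * bergman_norm g / (1 - \<rho>)\<^sup>2 * norm (z - w)"
proof -
  define \<delta> where "\<delta> = 1 - \<rho>"
  have \<delta>: "\<delta> > 0" using \<rho> by (simp add: \<delta>_def)
  have hol: "g holomorphic_on ball 0 1" using g by (simp add: bergman_space_def)
  note B0 = bergman_norm_nonneg[of g]
  have far: "ball v (\<delta>/4) \<subseteq> ball 0 1" if "norm (v - of_real \<rho>) \<le> 3 * \<delta> / 4" for v :: complex
  proof
    fix x assume "x \<in> ball v (\<delta>/4)"
    moreover have "norm x \<le> norm (complex_of_real \<rho>) + norm (v - of_real \<rho>) + norm (x - v)" by norm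
    ultimately show "x \<in> ball 0 1" using that \<rho> \<delta> by (simp add: dist_norm norm_minus_commute \<delta>_def)
  qed
  have gb: "norm (g v) \<le> 4 * bergman_norm g / \<delta>" if v: "norm (v - of_real \<rho>) \<le> 3 * \<delta> / 4" for v
  proof -
    have "1 * (\<delta>/4)\<^sup>2 * (norm (g v))\<^sup>2 \<le> pi * (\<delta>/4)\<^sup>2 * (norm (g v))\<^sup>2"
      using pi_ge_two by (intro mult_right_mono) auto
    also have "\<dots> \<le> (bergman_norm g)\<^sup>2"
      using \<delta> by (intro bergman_pointwise_bound[OF g far[OF v]]) auto
    finally have "(\<delta>/4 * norm (g v))\<^sup>2 \<le> (bergman_norm g)\<^sup>2"
      by (simp only: power_mult_distrib mult_1)
    then have "\<delta>/4 * norm (g v) \<le> bergman_norm g" using B0 power2_le_imp_le by blast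
    then show ?thesis using \<delta> by (simp add: field_simps)
  qed
  have deriv_bound: "norm (deriv g u) \<le> 32 * bergman_norm g / \<delta>\<^sup>2"
    if u: "u \<in> ball (of_real \<rho>) (\<delta>/2)" for u
  proof -
    have ur: "norm (u - of_real \<rho>) < \<delta>/2" using u by (simp add: dist_norm norm_minus_commute)
    have sub: "cball u (\<delta>/8) \<subseteq> ball 0 1"
      using far[of u] ur \<delta> by (auto simp: subset_iff)
    have "norm ((deriv ^^ 1) g u) \<le> fact 1 * (4 * bergman_norm g / \<delta>) / (\<delta>/8) ^ 1"
    proof (rule Cauchy_inequality)
      show "g holomorphic_on ball u (\<delta>/8)"
        using sub ball_subset_cball by (blast intro: holomorphic_on_subset[OF hol])
      show "continuous_on (cball u (\<delta>/8)) g"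
        using sub by (blast intro: continuous_on_subset[OF holomorphic_on_imp_continuous_on[OF hol]])
      show "0 < \<delta>/8" using \<delta> by simp
      fix x assume x: "norm (u - x) = \<delta>/8"
      have "norm (x - of_real \<rho>) \<le> norm (u - x) + norm (u - of_real \<rho>)" by norm
      then show "norm (g x) \<le> 4 * bergman_norm g / \<delta>"
        using x ur \<delta> by (intro gb) auto
    qed
    then show ?thesis using \<delta> by (simp add: power2_eq_square)
  qed
  have ball: "ball (complex_of_real \<rho>) (\<delta>/2) \<subseteq> ball 0 1"
    using one_minus_norm_bounds(1)[OF \<rho>] by (auto simp: \<delta>_def)
  have "norm (g z - g w) \<le> 32 * bergman_norm g / \<delta>\<^sup>2 * norm (z - w)"
  proof (rule field_differentiable_bound[where S="ball (of_real \<rho>) (\<delta>/2)"])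
    fix u assume u: "u \<in> ball (complex_of_real \<rho>) (\<delta>/2)"
    show "(g has_field_derivative deriv g u) (at u within ball (of_real \<rho>) (\<delta>/2))"
      using holomorphic_derivI[OF hol] u ball has_field_derivative_at_within by (metis open_ball subsetD)
  qed (use deriv_bound z w in \<open>auto simp: \<delta>_def\<close>)
  then show ?thesis by (simp add: \<delta>_def)
qed

text \<open>Choose disjoint pairs z_n, w_n at distance at most \<delta>/4^n, where \<delta> is the
  distance of the cluster centre from the unit circle. Prescribe the weighted value 2^-n at z_n and
  0 at all other points. The Lipschitz estimate forces 2^n to be at most 96 times the norm of the
  interpolating function, for every n.\<close>

lemma not_bergman_interpolating:
  assumes "clustered Z"
  shows "\<not> bergman_interpolating Z"
proof
  assume int: "bergman_interpolating Z"
  define close where "close k z w \<longleftrightarrow> (\<exists>\<rho>\<in>{0<..<1}. z \<in> ball (complex_of_real \<rho>) ((1 - \<rho>) / (2 * 4^k)) \<and>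
      w \<in> ball (of_real \<rho>) ((1 - \<rho>) / (2 * 4^k)))" for k :: nat and z w :: complex
  have pair: "\<exists>z w. z \<in> Z - S \<and> w \<in> Z - S \<and> z \<noteq> w \<and> close k z w" if "finite S" for S k
  proof -
    \<comment> \<open>Removing the points of \<open>S\<close> leaves at least 2 * 4^k of them, hence
      two distinct ones, and \<open>N\<close> is large enough for the radius required by
      \<open>close\<close>.\<close>
    define N where "N = 2 * 4^k + card S"
    have "N > 0" by (simp add: N_def)
    then obtain \<rho> C where \<rho>: "\<rho> \<in> {0<..<1}" and C: "finite C" "card C = N"
        "C \<subseteq> Z \<inter> ball (of_real \<rho>) ((1 - \<rho>) / N)"
      using assms unfolding clustered_def by blast
    have "card (C - S) \<ge> N - card S" using that C(2) by (metis diff_card_le_card_Diff)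
    moreover have "N - card S \<ge> 2" by (simp add: N_def)
    ultimately have "card (C - S) \<ge> Suc (Suc 0)" by linarith
    then obtain z w where zw: "z \<in> C - S" "w \<in> C - S" "z \<noteq> w"
      by (auto simp: card_le_Suc_iff)
    have "(1 - \<rho>) / real N \<le> (1 - \<rho>) / (2 * 4^k)"
      using \<rho> by (intro divide_left_mono) (auto simp: N_def intro!: mult_pos_pos add_pos_nonneg)
    then have "close k z w" unfolding close_def using zw C(3) \<rho> by (intro bexI[of _ \<rho>]) fastforce+
    with zw C(3) show ?thesis by blast
  qed
  \<comment> \<open>States of the dependent choice: \<open>S\<close> holds the points used before
    and (z, w) is a fresh pair. \<open>Q\<close> adds the pair to the used points.\<close>
  define P where "P = (\<lambda>k (S, z, w). finite S \<and> z \<in> Z - S \<and> w \<in> Z - S \<and> z \<noteq> w \<and> close k z w)"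
  define Q where "Q = (\<lambda>(n::nat) (S, z::complex, w) (S', _::complex, _::complex). S' = insert z (insert w S))"
  have "\<exists>f. \<forall>n. P n (f n) \<and> Q n (f n) (f (Suc n))"
  proof (rule dependent_nat_choice)
    show "\<exists>x. P 0 x" using pair[of "{}" 0] by (auto simp: P_def)
  next
    fix x n assume "P n x"
    obtain S z w where x: "x = (S, z, w)" by (cases x)
    have "finite (insert z (insert w S))" using \<open>P n x\<close> by (simp add: x P_def)
    from pair[OF this, of "Suc n"] obtain z' w' where
      "P (Suc n) (insert z (insert w S), z', w')" using \<open>P n x\<close> by (auto simp: P_def x)
    then show "\<exists>y. P (Suc n) y \<and> Q n x y"
      by (auto simp: x Q_def)
  qed
  then obtain f where f: "\<And>n. P n (f n)"
     "\<And>n. Q n (f n) (f (Suc n))" by blast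
  define S z w where "S n = fst (f n)" and "z n = fst (snd (f n))" and "w n = snd (snd (f n))" for n
  have zw: "z n \<in> Z - S n" "w n \<in> Z - S n" "z n \<noteq> w n" "close n (z n) (w n)" for n
    using f(1)[of n] by (auto simp: P_def S_def z_def w_def split: prod.splits)
  have Suc: "S (Suc n) = insert (z n) (insert (w n) (S n))" for n
    using f(2)[of n] by (auto simp: Q_def S_def z_def w_def split: prod.splits)
  have mono: "m \<le> n \<Longrightarrow> S m \<subseteq> S n" for m n
    by (rule lift_Suc_mono_le) (auto simp: Suc)
  have less: "z m \<in> S n \<and> w m \<in> S n" if "m < n" for m n
    using mono[of "Suc m" n] that by (auto simp: Suc)
  have inj: "inj z"
    by (rule linorder_injI) (use less zw(1) in fastforce)
  \<comment> \<open>For equal indices the two points of a pair differ; otherwise the later pair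
    avoids the earlier one. Hence data supported on the range of \<open>z\<close> vanish at every
    \<open>w m\<close>.\<close>
  have wz: "w m \<noteq> z n" for m n
    using less[of m n] less[of n m] zw[of m] zw[of n] by (metis DiffD2 linorder_neqE_nat)
  \<comment> \<open>\<open>inv z x\<close> recovers the index of the pair. After weighting, the
    squared data form the geometric series with ratio 1/4.\<close>
  define a where "a x = (if x \<in> range z
      then complex_of_real ((1/2) ^ inv z x / (1 - (cmod x)\<^sup>2)) else 0)" for x
  have half: "z n \<in> ball (of_real \<rho>) ((1 - \<rho>) / 2) \<and> w n \<in> ball (of_real \<rho>) ((1 - \<rho>) / 2)"
    if "\<rho> \<in> {0<..<1}" "z n \<in> ball (complex_of_real \<rho>) ((1 - \<rho>) / (2 * 4^n))"
      "w n \<in> ball (complex_of_real \<rho>) ((1 - \<rho>) / (2 * 4^n))" for \<rho> n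
  proof -
    have "(1 - \<rho>) / (2 * 4^n) \<le> (1 - \<rho>) / 2"
      using that(1) by (intro divide_left_mono) auto
    from subset_ball[OF this] show ?thesis using that by blast
  qed
  have az: "a (z n) * of_real (1 - (cmod (z n))\<^sup>2) = of_real ((1/2)^n)" for n
  proof -
    obtain \<rho> where "\<rho> \<in> {0<..<1}" "z n \<in> ball (of_real \<rho>) ((1 - \<rho>) / 2)"
      using zw(4)[of n] half unfolding close_def by blast
    then have "1 - (cmod (z n))\<^sup>2 > 0" using one_minus_norm_bounds(2)[of \<rho> "z n"] by auto
    then have "complex_of_real (1 - (cmod (z n))\<^sup>2) \<noteq> 0" by (metis less_irrefl of_real_eq_0_iff)
    then show ?thesis using inj by (simp add: a_def)
  qed
  have "(\<lambda>x. (cmod (a x * of_real (1 - (cmod x)\<^sup>2)))\<^sup>2) summable_on range z"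
  proof (subst summable_on_reindex[OF inj])
    have "((\<lambda>x. (cmod (a x * of_real (1 - (cmod x)\<^sup>2)))\<^sup>2) \<circ> z) = (\<lambda>n. (1/4)^n)"
      by (rule ext) (simp only: o_def az, simp add: norm_power norm_divide power_divide flip: power_mult,
        simp add: power_mult power2_eq_square flip: power_mult_distrib)
    then show "((\<lambda>x. (cmod (a x * of_real (1 - (cmod x)\<^sup>2)))\<^sup>2) \<circ> z) summable_on UNIV"
      by (simp only:, intro norm_summable_imp_summable_on) (simp add: norm_power summable_geometric)
  qed
  then have "(\<lambda>x. (cmod (a x * of_real (1 - (cmod x)\<^sup>2)))\<^sup>2) summable_on Z"
    by (rule summable_on_cong_neutral[THEN iffD1, rotated -1]) (use zw(1) in \<open>auto simp: a_def\<close>)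
  then obtain g where g: "g \<in> bergman_space" "\<And>x. x \<in> Z \<Longrightarrow> g x = a x"
    using int unfolding bergman_interpolating_def by blast
  have "(2::real)^n \<le> 96 * bergman_norm g" for n
  proof -
    obtain \<rho> where \<rho>: "\<rho> \<in> {0<..<1}" "z n \<in> ball (of_real \<rho>) ((1 - \<rho>) / (2 * 4^n))"
        "w n \<in> ball (of_real \<rho>) ((1 - \<rho>) / (2 * 4^n))"
      using zw(4)[of n] unfolding close_def by blast
    note h = half[OF \<rho>]
    define \<delta> where "\<delta> = 1 - \<rho>"
    have \<delta>: "\<delta> > 0" using \<rho> by (simp add: \<delta>_def)
    have "norm (z n - w n) \<le> norm (of_real \<rho> - z n) + norm (of_real \<rho> - w n)" by norm
    then have d: "norm (z n - w n) \<le> \<delta> / 4^n"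
      using \<rho>(2,3) by (auto simp: dist_norm \<delta>_def)
    note B0 = bergman_norm_nonneg[of g]
    have "g (w n) = 0" using g(2)[of "w n"] zw(2)[of n] wz by (auto simp: a_def)
    moreover have "g (z n) = a (z n)" using g(2) zw(1)[of n] by blast
    ultimately have "norm (g (z n) - g (w n)) * (1 - (cmod (z n))\<^sup>2) = (1/2)^n"
      using arg_cong[OF az[of n], of norm] one_minus_norm_bounds(2)[OF \<rho>(1), of "z n"] h \<delta>
      by (simp add: norm_mult norm_power norm_divide \<delta>_def del: of_real_diff of_real_power)
    then have "(1/2)^n = norm (g (z n) - g (w n)) * (1 - (cmod (z n))\<^sup>2)" by simp
    \<comment> \<open>The Lipschitz constant is multiplied by the distance \<delta>/4^n and the
      weight bound 3\<delta>, so all powers of \<open>\<delta>\<close> cancel and 32 * 3 = 96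
      remains.\<close>
    also have "\<dots> \<le> (32 * bergman_norm g / \<delta>\<^sup>2 * (\<delta> / 4^n)) * (3 * \<delta>)"
    proof (intro mult_mono)
      have "norm (g (z n) - g (w n)) \<le> 32 * bergman_norm g / \<delta>\<^sup>2 * norm (z n - w n)"
        unfolding \<delta>_def using h by (intro bergman_lipschitz[OF g(1) \<rho>(1)]) auto
      also have "\<dots> \<le> 32 * bergman_norm g / \<delta>\<^sup>2 * (\<delta> / 4^n)"
        using d B0 by (intro mult_left_mono) auto
      finally show "norm (g (z n) - g (w n)) \<le> 32 * bergman_norm g / \<delta>\<^sup>2 * (\<delta> / 4^n)" .
    qed (use one_minus_norm_bounds[OF \<rho>(1), of "z n"] h \<delta> B0 in \<open>auto simp: \<delta>_def\<close>)
    also have "\<dots> = 96 * bergman_norm g / 4^n" using \<delta> by (simp add: power2_eq_square)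
    finally have "(1/2)^n * 4^n \<le> 96 * bergman_norm g" by (simp add: field_simps)
    then show ?thesis by (simp flip: power_mult_distrib)
  qed
  moreover obtain n where "96 * bergman_norm g < 2 ^ n" using real_arch_pow[of 2] by force
  ultimately show False by (meson not_le)
qed

text \<open>Enclose the disc in the square with sides [-1, 1] and replace one factor (b - x)^2 + y^2
  of the denominator by (b - x)^2. The y-integral is then an arctangent difference, at most pi / (b
  - x)^3, and the x-integral is elementary.\<close>

lemma nn_integral_inverse_power4_le:
  assumes b: "b > 1"
  shows "(\<integral>\<^sup>+z\<in>ball 0 1. ennreal (1 / cmod (of_real b - z) ^ 4) \<partial>lborel) \<le> ennreal (pi / (2 * (b - 1)\<^sup>2))"
proof -
  have inner: "(\<integral>\<^sup>+y\<in>{-1..1}. ennreal (1 / (a\<^sup>2 * (a\<^sup>2 + y\<^sup>2))) \<partial>lborel) \<le> ennreal (pi / a^3)" if a: "a > 0" for a :: real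
  proof -
    have "(\<integral>\<^sup>+y\<in>{-1..1}. ennreal (1 / (a\<^sup>2 * (a\<^sup>2 + y\<^sup>2))) \<partial>lborel)
        = ennreal (arctan (1 / a) / a^3 - arctan (- 1 / a) / a^3)"
    proof (rule nn_integral_FTC_Icc[where F="\<lambda>y. arctan (y / a) / a^3"])
      fix y :: real
      have "((\<lambda>y. arctan (y / a)) has_real_derivative inverse (1 + (y/a)\<^sup>2) * (1 / a)) (at y)"
        using a by (auto intro!: derivative_eq_intros)
      then have "((\<lambda>y. arctan (y / a) / a^3) has_real_derivative inverse (1 + (y/a)\<^sup>2) * (1 / a) / a^3) (at y)"
        by (rule DERIV_cdivide)
      also have "inverse (1 + (y/a)\<^sup>2) * (1 / a) / a^3 = 1 / (a\<^sup>2 * (a\<^sup>2 + y\<^sup>2))"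
      proof -
        have "1 + (y/a)\<^sup>2 = (a\<^sup>2 + y\<^sup>2) / a\<^sup>2" using a by (simp add: field_simps)
        then have "inverse (1 + (y/a)\<^sup>2) = a\<^sup>2 / (a\<^sup>2 + y\<^sup>2)" by simp
        then show ?thesis using a by (simp add: power2_eq_square power3_eq_cube)
      qed
      finally show "((\<lambda>y. arctan (y / a) / a^3) has_real_derivative 1 / (a\<^sup>2 * (a\<^sup>2 + y\<^sup>2))) (at y)" .
    qed (use a in auto)
    also have "\<dots> \<le> ennreal (pi / a^3)"
    proof (rule ennreal_leI)
      have "arctan (1/a) - arctan (-1/a) \<le> pi"
        using arctan_ubound[of "1/a"] arctan_lbound[of "-1/a"] by linarith
      from divide_right_mono[OF this, of "a^3"] a
      show "arctan (1 / a) / a^3 - arctan (- 1 / a) / a^3 \<le> pi / a^3"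
        by (simp only: diff_divide_distrib) simp
    qed
    finally show ?thesis .
  qed
  have outer: "(\<integral>\<^sup>+x\<in>{-1..1}. ennreal (pi / (b - x)^3) \<partial>lborel)
      = ennreal (pi / (2 * (b - 1)\<^sup>2) - pi / (2 * (b - (-1))\<^sup>2))"
  proof (rule nn_integral_FTC_Icc[where F="\<lambda>x. pi / (2 * (b - x)\<^sup>2)"])
    fix x :: real assume x: "x \<in> {-1..1}"
    define a where "a = b - x"
    have a: "a > 0" using b x by (simp add: a_def)
    have "((\<lambda>u. pi / (2 * u\<^sup>2)) has_real_derivative - (pi / a^3)) (at (b - x))"
      unfolding a_def[symmetric] using a
      by (auto intro!: derivative_eq_intros simp: field_simps power2_eq_square power3_eq_cube)
    then have "((\<lambda>x. pi / (2 * (b - x)\<^sup>2)) has_real_derivative - (pi / a^3) * (-1)) (at x)"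
      by (rule DERIV_chain2) (auto intro!: derivative_eq_intros)
    then show "((\<lambda>x. pi / (2 * (b - x)\<^sup>2)) has_real_derivative pi / (b - x)^3) (at x)"
      by (simp add: a_def)
  qed (use b in auto)
  have pt: "indicator (ball 0 1) (Complex x y) * ennreal (1 / cmod (of_real b - Complex x y) ^ 4)
     \<le> indicator {-1..1} x * (ennreal (1 / ((b-x)\<^sup>2 * ((b-x)\<^sup>2 + y\<^sup>2))) * indicator {-1..1} y)" for x y
  proof (cases "Complex x y \<in> ball 0 1")
    case True
    have xy: "\<bar>x\<bar> \<le> 1" "\<bar>y\<bar> \<le> 1"
      using True abs_Re_le_cmod[of "Complex x y"] abs_Im_le_cmod[of "Complex x y"] by auto
    have x1: "x < b" using xy b by auto
    have "cmod (of_real b - Complex x y) ^ 4 = ((cmod (of_real b - Complex x y))\<^sup>2)\<^sup>2" by simp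
    also have "\<dots> = ((b-x)\<^sup>2 + y\<^sup>2)\<^sup>2" by (simp add: cmod_power2)
    also have "\<dots> \<ge> (b-x)\<^sup>2 * ((b-x)\<^sup>2 + y\<^sup>2)"
      by (simp only: power2_eq_square[of "_ + _"]) (intro mult_right_mono, auto)
    finally have "1 / cmod (of_real b - Complex x y) ^ 4 \<le> 1 / ((b-x)\<^sup>2 * ((b-x)\<^sup>2 + y\<^sup>2))"
      using x1 by (intro divide_left_mono) (auto intro!: mult_pos_pos add_pos_nonneg simp: complex_eq_iff)
    moreover have "x \<in> {-1..1}" "y \<in> {-1..1}" using xy by auto
    ultimately show ?thesis using True by (simp add: ennreal_leI)
  qed simp
  have m: "(\<lambda>z. ennreal (1 / cmod (of_real b - z) ^ 4) * indicator (ball 0 1) z) \<in> borel_measurable borel"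
  proof -
    have [measurable]: "ball 0 1 \<in> sets (borel :: complex measure)" by simp
    show ?thesis by measurable
  qed
  have "(\<integral>\<^sup>+z\<in>ball 0 1. ennreal (1 / cmod (of_real b - z) ^ 4) \<partial>lborel) =
     (\<integral>\<^sup>+x. \<integral>\<^sup>+y. indicator (ball 0 1) (Complex x y) * ennreal (1 / cmod (of_real b - Complex x y) ^ 4) \<partial>lborel \<partial>lborel)"
    unfolding nn_integral_lborel_complex[OF m] by (intro nn_integral_cong, rule mult.commute)
  also have "\<dots> \<le> (\<integral>\<^sup>+x. \<integral>\<^sup>+y. indicator {-1..1} x * (ennreal (1 / ((b-x)\<^sup>2 * ((b-x)\<^sup>2 + y\<^sup>2))) * indicator {-1..1} y) \<partial>lborel \<partial>lborel)"
    by (intro nn_integral_mono pt)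
  also have "\<dots> = (\<integral>\<^sup>+x. indicator {-1..1} x * (\<integral>\<^sup>+y. (ennreal (1 / ((b-x)\<^sup>2 * ((b-x)\<^sup>2 + y\<^sup>2))) * indicator {-1..1} y) \<partial>lborel) \<partial>lborel)"
    by (intro nn_integral_cong nn_integral_cmult) measurable
  also have "\<dots> \<le> (\<integral>\<^sup>+x. ennreal (pi / (b - x)^3) * indicator {-1..1} x \<partial>lborel)"
    by (intro nn_integral_mono) (use inner b in \<open>auto split: split_indicator\<close>)
  also have "\<dots> = ennreal (pi / (2 * (b - 1)\<^sup>2) - pi / (2 * (b - (-1))\<^sup>2))" by (rule outer)
  also have "\<dots> \<le> ennreal (pi / (2 * (b - 1)\<^sup>2))" by (intro ennreal_leI) auto
  finally show ?thesis .
qed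

text \<open>For a test function concentrated at a cluster of N points, each of them contributes at
  least a fixed multiple of the squared norm, so the upper sampling inequality bounds N by 162 * C *
  pi.\<close>

lemma not_bergman_sampling:
  assumes "clustered Z"
  shows "\<not> bergman_sampling Z"
proof
  assume "bergman_sampling Z"
  then obtain C where C: "C > 0" and upper: "\<And>g. g \<in> bergman_space \<Longrightarrow>
        (\<lambda>z. (cmod (g z))\<^sup>2 * (1 - (cmod z)\<^sup>2)\<^sup>2) summable_on Z \<and>
        (\<Sum>\<^sub>\<infinity>z\<in>Z. (cmod (g z))\<^sup>2 * (1 - (cmod z)\<^sup>2)\<^sup>2) \<le> C * (bergman_norm g)\<^sup>2"
    unfolding bergman_sampling_def by blast
  have "real N \<le> 162 * C * pi" if N: "N \<ge> 2" for N :: nat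
  proof -
    obtain \<rho> S where \<rho>: "\<rho> \<in> {0<..<1}" and S: "finite S" "card S = N"
        "S \<subseteq> Z \<inter> ball (of_real \<rho>) ((1 - \<rho>) / N)"
      using assms N unfolding clustered_def by (metis (no_types, lifting) less_le_trans pos2)
    define \<delta> where "\<delta> = 1 - \<rho>"
    have \<delta>: "\<delta> > 0" using \<rho> by (simp add: \<delta>_def)
    \<comment> \<open>Up to a constant factor this is the Bergman kernel at the point 1 / (1 +
      \<delta>), which is close to \<rho> = 1 - \<delta>. Its pole lies at distance \<delta> outside
      the disc.\<close>
    define g where "g z = 1 / (of_real (1 + \<delta>) - z)\<^sup>2" for z :: complex
    have nz: "of_real (1 + \<delta>) - z \<noteq> 0" if "norm z < 1" for z :: complex
      using that \<delta> by (metis abs_of_pos add_less_same_cancel1 add_pos_pos eq_iff_diff_eq_0 less_asym norm_of_real zero_less_one)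
    have hol: "g holomorphic_on ball 0 1"
      unfolding g_def using nz by (intro holomorphic_intros) auto
    have sq: "(cmod (g z))\<^sup>2 = 1 / cmod (of_real (1 + \<delta>) - z) ^ 4" for z
      by (simp add: g_def norm_divide norm_power power_divide flip: power_mult)
    have le: "(\<integral>\<^sup>+z\<in>ball 0 1. ennreal ((cmod (g z))\<^sup>2) \<partial>lborel) \<le> ennreal (pi / (2 * \<delta>\<^sup>2))"
      using nn_integral_inverse_power4_le[of "1 + \<delta>"] \<delta> by (simp only: sq) simp
    have "set_integrable lborel (ball 0 1) (\<lambda>z. (cmod (g z))\<^sup>2)"
      unfolding set_integrable_def
    proof (rule integrableI_bounded)
      have c: "continuous_on (ball 0 1) (\<lambda>z. (cmod (g z))\<^sup>2)"
        by (intro continuous_intros holomorphic_on_imp_continuous_on[OF hol])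
      show "(\<lambda>z. indicator (ball 0 1) z *\<^sub>R (cmod (g z))\<^sup>2) \<in> borel_measurable lborel"
        using borel_measurable_continuous_on_indicator[OF _ c] by simp
      have "(\<integral>\<^sup>+z. ennreal (norm (indicator (ball 0 1) z *\<^sub>R (cmod (g z))\<^sup>2)) \<partial>lborel)
         = (\<integral>\<^sup>+z\<in>ball 0 1. ennreal ((cmod (g z))\<^sup>2) \<partial>lborel)"
        by (intro nn_integral_cong) (auto split: split_indicator)
      then show "(\<integral>\<^sup>+z. ennreal (norm (indicator (ball 0 1) z *\<^sub>R (cmod (g z))\<^sup>2)) \<partial>lborel) < \<infinity>"
        using le by (simp add: order_le_less_trans)
    qed
    then have g: "g \<in> bergman_space" using hol by (simp add: bergman_space_def)
    have nb: "(bergman_norm g)\<^sup>2 \<le> pi / (2 * \<delta>\<^sup>2)"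
      using le \<delta> unfolding bergman_norm_power2[OF g, symmetric] by (subst (asm) ennreal_le_iff) auto
    \<comment> \<open>The constant is 324 = 3^4 * 2^2: the distance to the pole is at most 3\<delta>
      and the weight is at least \<delta>/2.\<close>
    have term_ge: "1 / (324 * \<delta>\<^sup>2) \<le> (cmod (g z))\<^sup>2 * (1 - (cmod z)\<^sup>2)\<^sup>2" if "z \<in> S" for z
    proof -
      have "\<delta> / N \<le> \<delta> / 2" using N \<delta> by (intro divide_left_mono) auto
      from subset_ball[OF this] have z: "z \<in> ball (of_real \<rho>) ((1 - \<rho>) / 2)"
        using that S(3) unfolding \<delta>_def by blast
      note ob = one_minus_norm_bounds[OF \<rho> z]
      have "norm (of_real (1 + \<delta>) - z) \<le> norm (complex_of_real (1 + \<delta> - \<rho>)) + norm (of_real \<rho> - z)"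
        using norm_triangle_ineq[of "complex_of_real (1 + \<delta> - \<rho>)" "of_real \<rho> - z"] by (simp add: algebra_simps)
      also have "\<dots> \<le> 3 * \<delta>"
        using z \<delta> by (simp add: dist_norm \<delta>_def del: of_real_diff of_real_add)
      finally have "cmod (of_real (1 + \<delta>) - z) ^ 4 \<le> (3 * \<delta>) ^ 4"
        by (intro power_mono) auto
      then have "1 / (3 * \<delta>) ^ 4 \<le> (cmod (g z))\<^sup>2"
        unfolding sq using nz[OF ob(1)] \<delta> by (intro divide_left_mono) auto
      moreover have "(\<delta> / 2)\<^sup>2 \<le> (1 - (cmod z)\<^sup>2)\<^sup>2"
        using ob \<delta> by (intro power_mono) (auto simp: \<delta>_def)
      ultimately have "1 / (3 * \<delta>) ^ 4 * (\<delta> / 2)\<^sup>2 \<le> (cmod (g z))\<^sup>2 * (1 - (cmod z)\<^sup>2)\<^sup>2"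
        using \<delta> by (intro mult_mono) auto
      moreover have "1 / (324 * \<delta>\<^sup>2) \<le> 1 / (3 * \<delta>) ^ 4 * (\<delta> / 2)\<^sup>2"
        using \<delta> by (simp add: field_simps power2_eq_square power4_eq_xxxx)
      ultimately show ?thesis by linarith
    qed
    have "real N * (1 / (324 * \<delta>\<^sup>2)) = (\<Sum>z\<in>S. 1 / (324 * \<delta>\<^sup>2))" using S by simp
    also have "\<dots> \<le> (\<Sum>z\<in>S. (cmod (g z))\<^sup>2 * (1 - (cmod z)\<^sup>2)\<^sup>2)" by (intro sum_mono term_ge)
    also have "\<dots> \<le> (\<Sum>\<^sub>\<infinity>z\<in>Z. (cmod (g z))\<^sup>2 * (1 - (cmod z)\<^sup>2)\<^sup>2)"
      using upper[OF g] S by (intro finite_sum_le_infsum) auto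
    also have "\<dots> \<le> C * (pi / (2 * \<delta>\<^sup>2))"
      using upper[OF g] nb C by (meson mult_left_mono less_imp_le order_trans)
    finally show ?thesis using \<delta> C by (simp add: field_simps)
  qed
  moreover obtain n :: nat where "162 * C * pi < n" using reals_Archimedean2 by blast
  ultimately have "real (max n 2) \<le> 162 * C * pi" "real (max n 2) > 162 * C * pi" by auto
  then show False by linarith
qed

subsection \<open>Clusters of zeros near a block series\<close>

text \<open>The ratio exp (-1/(2M)) is the modulus of exp (-u/M) for Re u = 1/2, so it dominates the
  points with Re u > 1/2 used later. With values in \<open>ennreal\<close> the sum is defined and
  measurable before its convergence is known.\<close>

definition growth :: "nat \<Rightarrow> (nat \<Rightarrow> complex) \<Rightarrow> ennreal" where
  "growth M x = (\<Sum>n. ennreal (cmod (\<Sum>k\<le>n. x k) * exp (- 1 / (2 * real M)) ^ n))"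

text \<open>The coefficient of index i of \<open>P\<close> fills a whole block of length
  \<open>M\<close>; the factor 1 / sqrt M keeps the square sum independent of
  \<open>M\<close>.\<close>

definition block_coeffs :: "complex poly \<Rightarrow> nat \<Rightarrow> nat \<Rightarrow> complex" where
  "block_coeffs P M k = coeff P (k div M) / of_real (sqrt M)"

text \<open>Abel summation: with partial sums T_n of the coefficients, the series equals (1 - z)
  times the sum of T_n z^n. Finite growth makes the latter absolutely convergent, so convergence of
  the original series is also a result.\<close>

lemma power_series_growth:
  assumes fin: "growth M x < \<infinity>" and z: "norm z \<le> exp (- 1 / (2 * real M))"
  shows "summable (\<lambda>k. x k * z ^ k)"
    and "norm (\<Sum>k. x k * z ^ k) \<le> norm (1 - z) * enn2real (growth M x)"
proof -
  define q where "q = exp (- 1 / (2 * real M))"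
  define T where "T n = (\<Sum>k\<le>n. x k)" for n
  have zq: "norm z \<le> q" using z by (simp add: q_def)
  have nn: "0 \<le> norm (T n) * q ^ n" for n by (simp add: q_def)
  have g: "growth M x = (\<Sum>n. ennreal (norm (T n) * q ^ n))" by (simp add: growth_def q_def T_def)
  have sm: "summable (\<lambda>n. norm (T n) * q ^ n)"
    using fin nn unfolding g by (intro summable_suminf_not_top) auto
  have gs: "enn2real (growth M x) = (\<Sum>n. norm (T n) * q ^ n)"
    unfolding g using suminf_ennreal2[OF nn sm] suminf_nonneg[OF sm nn] by simp
  have le: "norm (T n * z ^ n) \<le> norm (T n) * q ^ n" for n
    unfolding norm_mult norm_power using zq by (intro mult_left_mono power_mono) auto
  have smn: "summable (\<lambda>n. norm (T n * z ^ n))"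
    by (rule summable_comparison_test'[OF sm, of 0]) (simp only: real_norm_def abs_norm_cancel le)
  then have s1: "(\<lambda>n. T n * z ^ n) sums (\<Sum>n. T n * z ^ n)"
    by (rule summable_sums[OF summable_norm_cancel])
  then have "(\<lambda>n. z * (T n * z ^ n)) sums (z * (\<Sum>n. T n * z ^ n))" by (rule sums_mult)
  \<comment> \<open>The series of T_(n-1) z^n, with the value 0 at n = 0 standing for an empty
    partial sum. Subtracting it leaves x_n z^n.\<close>
  then have "(\<lambda>n. case n of 0 \<Rightarrow> 0 | Suc n \<Rightarrow> z * (T n * z ^ n)) sums (z * (\<Sum>n. T n * z ^ n))"
    using sums_Suc_iff[of "\<lambda>n. case n of 0 \<Rightarrow> 0 | Suc n \<Rightarrow> z * (T n * z ^ n)"] by simp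
  from sums_diff[OF s1 this]
  have "(\<lambda>n. T n * z ^ n - (case n of 0 \<Rightarrow> 0 | Suc n \<Rightarrow> z * (T n * z ^ n)))
     sums ((1 - z) * (\<Sum>n. T n * z ^ n))" by (simp add: algebra_simps)
  moreover have "(\<lambda>n. T n * z ^ n - (case n of 0 \<Rightarrow> 0 | Suc n \<Rightarrow> z * (T n * z ^ n))) = (\<lambda>n. x n * z ^ n)"
    by (rule ext) (auto simp: T_def algebra_simps split: nat.splits)
  ultimately have sums: "(\<lambda>n. x n * z ^ n) sums ((1 - z) * (\<Sum>n. T n * z ^ n))" by simp
  then show "summable (\<lambda>k. x k * z ^ k)" by (rule sums_summable)
  have "norm (\<Sum>n. T n * z ^ n) \<le> (\<Sum>n. norm (T n * z ^ n))" by (rule summable_norm[OF smn])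
  also have "\<dots> \<le> (\<Sum>n. norm (T n) * q ^ n)" by (rule suminf_le[OF le smn sm])
  finally show "norm (\<Sum>k. x k * z ^ k) \<le> norm (1 - z) * enn2real (growth M x)"
    unfolding sums_unique[OF sums, symmetric] norm_mult gs by (intro mult_left_mono) auto
qed

lemma block_coeffs_eq_0:
  assumes "M > 0" "k \<ge> Suc (degree P) * M"
  shows "block_coeffs P M k = 0"
proof -
  have "k div M \<ge> Suc (degree P)" using assms by (simp add: less_eq_div_iff_mult_less_eq)
  then show ?thesis by (simp add: block_coeffs_def coeff_eq_0)
qed

text \<open>Writing k = i M + j separates the sum into P (z^M) and a geometric sum over one
  block.\<close>

lemma block_coeffs_sums:
  assumes M: "M > 0"
  shows "(\<lambda>k. block_coeffs P M k * z ^ k) sums (poly P (z ^ M) * (\<Sum>j<M. z ^ j) / of_real (sqrt M))"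
proof -
  define d where "d = Suc (degree P)"
  note 0 = block_coeffs_eq_0[OF M, of P, folded d_def]
  have "(\<Sum>k<d * M. block_coeffs P M k * z ^ k) =
      (\<Sum>i<d. \<Sum>k=i*M..<i*M+M. block_coeffs P M k * z ^ k)" by (rule sum.nat_group[symmetric])
  also have "\<dots> = (\<Sum>i<d. \<Sum>j<M. block_coeffs P M (i * M + j) * z ^ (i * M + j))"
  proof (rule sum.cong[OF refl])
    fix i
    show "(\<Sum>k=i*M..<i*M+M. block_coeffs P M k * z ^ k) = (\<Sum>j<M. block_coeffs P M (i * M + j) * z ^ (i * M + j))"
      using sum.shift_bounds_nat_ivl[of "\<lambda>k. block_coeffs P M k * z ^ k" 0 "i*M" M]
      by (simp add: add.commute atLeast0LessThan)
  qed
  also have "\<dots> = (\<Sum>i<d. \<Sum>j<M. coeff P i * (z ^ M) ^ i * (z ^ j / of_real (sqrt M)))"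
    by (intro sum.cong refl) (simp add: block_coeffs_def power_add power_mult mult.commute[of _ M])
  also have "\<dots> = (\<Sum>i<d. coeff P i * (z ^ M) ^ i) * (\<Sum>j<M. z ^ j / of_real (sqrt M))"
    by (simp add: sum_product)
  also have "\<dots> = poly P (z ^ M) * (\<Sum>j<M. z ^ j) / of_real (sqrt M)"
    by (simp add: poly_altdef d_def lessThan_Suc_atMost flip: sum_divide_distrib)
  finally have "(\<Sum>k<d * M. block_coeffs P M k * z ^ k) = poly P (z ^ M) * (\<Sum>j<M. z ^ j) / of_real (sqrt M)" .
  then show ?thesis
    using sums_finite[of "{..<d*M}" "\<lambda>k. block_coeffs P M k * z ^ k"] 0 by (simp add: not_less)
qed

lemma one_minus_exp_ge:
  fixes t :: real
  assumes "0 \<le> t" "t \<le> 1"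
  shows "t / 2 \<le> 1 - exp (- t)"
proof -
  have "exp (- t) \<le> 1 / (1 + t)"
    using exp_ge_add_one_self[of t] assms(1) by (simp add: exp_minus inverse_eq_divide divide_left_mono)
  moreover have "t * (1 + t) \<le> t * 2" using assms by (intro mult_left_mono) auto
  then have "1 / (1 + t) \<le> 1 - t / 2" using assms(1) by (simp add: field_simps)
  ultimately show ?thesis by linarith
qed

lemma norm_exp_minus_one_le: "norm (exp z - 1) \<le> exp \<bar>Re z\<bar> * norm (z :: complex)"
  using Taylor_exp[of z 0] by simp

text \<open>In the variable u with z = exp (-u/M) the rescaled random series \<open>F\<close>
  differs from c \<Psi>(u) by at most \<open>B\<close>, with a bound that does not depend on
  \<open>M\<close>. The zeros of \<Psi> are prescribed, and a large \<open>c\<close> makes them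
  persist for \<open>F\<close>. The polynomial is therefore fixed before \<open>M\<close> and the
  sequence are given.\<close>

lemma cluster_polynomial:
  fixes N :: nat and K :: real
  assumes N: "N > 0" and K: "K > 0"
  obtains P where "\<And>M x. M > 0 \<Longrightarrow> growth M (\<lambda>k. x k - block_coeffs P M k) \<le> ennreal (K * M powr (3/2)) \<Longrightarrow>
     \<exists>\<rho>\<in>{0<..<1}. \<exists>S. finite S \<and> card S = N \<and> S \<subseteq> gaf_zeros x \<inter> ball (of_real \<rho>) ((1 - \<rho>) / N)"
proof -
  \<comment> \<open>Centres spaced by 4r have disjoint discs of radius r. The choice of r keeps all
    of these discs within 1/(8N) of the point 1, which becomes the cluster radius after
    exponentiation.\<close>
  define r where "r = 1 / (64 * real N ^ 2)"
  define s where "s i = complex_of_real (1 + 4 * r * real i)" for i :: nat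
  have r0: "r > 0" using N by (simp add: r_def)
  have s1: "norm (s i - 1) \<le> 1 / (16 * N)" if "i < N" for i
  proof -
    have "s i - 1 = of_real (4 * r * i)" by (simp add: s_def)
    then have "norm (s i - 1) = 4 * r * i" using r0 by (simp del: of_real_mult)
    also have "\<dots> \<le> 4 * r * N" using that r0 by (intro mult_left_mono) auto
    also have "\<dots> = 1 / (16 * N)" using N by (simp add: r_def power2_eq_square)
    finally show ?thesis .
  qed
  have rN: "r \<le> 1 / (64 * N)" using N by (simp add: r_def field_simps power2_eq_square)
  have near: "norm (u - 1) < 1 / (8 * N)" if "u \<in> cball (s i) r" "i < N" for u i
  proof -
    have "norm (u - 1) \<le> norm (s i - 1) + norm (s i - u)" by norm
    also have "\<dots> \<le> 1 / (16 * N) + 1 / (64 * N)"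
      using that s1[OF that(2)] rN by (intro add_mono) (auto simp: dist_norm)
    also have "\<dots> < 1 / (8 * N)" using N by (simp add: field_simps)
    finally show ?thesis .
  qed
  have near8: "norm (u - 1) < 1 / 8" if "u \<in> cball (s i) r" "i < N" for u i
  proof -
    have "1 / (8 * real N) \<le> 1 / 8" using N by (simp add: field_simps)
    then show ?thesis using near[OF that] by linarith
  qed
  have sep: "norm (s i - s j) \<ge> 4 * r" if "i \<noteq> j" for i j
  proof -
    have "s i - s j = of_real (4 * r * (real i - real j))" by (simp add: s_def algebra_simps)
    then have "norm (s i - s j) = 4 * r * \<bar>real i - real j\<bar>"
      using r0 by (simp add: abs_mult del: of_real_mult of_real_diff)
    moreover have "\<bar>real i - real j\<bar> \<ge> 1" using that by linarith
    ultimately show ?thesis using r0 by simp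
  qed
  \<comment> \<open>Near 1 the imaginary parts differ by less than 2 pi. This keeps zeros found in
    different discs distinct and excludes further zeros of \<open>\<Psi>\<close> on the
    circles.\<close>
  have exp_inj: "u = v" if "exp (- u) = exp (- v)" "norm (u - 1) < 1 / 8" "norm (v - 1) < 1 / 8" for u v :: complex
  proof -
    have "\<bar>Im (u - 1)\<bar> < 1 / 8" "\<bar>Im (v - 1)\<bar> < 1 / 8"
      using that(2,3) abs_Im_le_cmod order_le_less_trans by blast+
    then have "\<bar>Im (- u) - Im (- v)\<bar> < 2 * pi" using pi_ge_two by simp
    then show ?thesis using exp_complex_eqI[of "-u" "-v"] that(1) by simp
  qed
  have re: "Re u > 1 / 2" "norm u \<le> 2" if "norm (u - 1) < 1 / 8" for u :: complex
  proof -
    have "\<bar>Re (u - 1)\<bar> < 1 / 8" using that abs_Re_le_cmod order_le_less_trans by blast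
    then show "Re u > 1 / 2" by (simp add: abs_if split: if_splits)
    show "norm u \<le> 2" using norm_triangle_ineq[of "u - 1" 1] that by simp
  qed
  define P0 where "P0 = (\<Prod>i<N. [:- exp (- s i), 1:])"
  \<comment> \<open>This is (1 - z) times the sum of z^j over one block times P0 (z^M), rewritten
    with z^M = exp (-u).\<close>
  define \<Psi> where "\<Psi> u = poly P0 (exp (- u)) * (1 - exp (- u))" for u
  have \<Psi>_zero: "\<Psi> (s i) = 0" if "i < N" for i
    using that by (auto simp: \<Psi>_def P0_def poly_prod)
  define \<Gamma> where "\<Gamma> = (\<Union>i<N. sphere (s i) r)"
  have \<Psi>_nz: "\<Psi> u \<noteq> 0" if u\<Gamma>: "u \<in> \<Gamma>" for u
  proof
    assume 0: "\<Psi> u = 0"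
    obtain i where i: "i < N" "u \<in> sphere (s i) r" using u\<Gamma> by (auto simp: \<Gamma>_def)
    have u8: "norm (u - 1) < 1/8" using near8[of u i] i by auto
    have "norm (exp (- u)) < 1" using re(1)[OF u8] by simp
    then have "1 - exp (- u) \<noteq> 0" by (metis norm_one less_irrefl eq_iff_diff_eq_0)
    then obtain j where j: "j < N" "exp (- u) = exp (- s j)" using 0 by (auto simp: \<Psi>_def P0_def poly_prod)
    then have "u = s j" using exp_inj[of u "s j"] u8 near8[of "s j" j] r0 by simp
    then have "norm (s i - s j) = r" using i by (simp add: dist_norm)
    then show False using sep[of i j] r0 by (cases "i = j") auto
  qed
  \<comment> \<open>The union of the circles is compact and free of zeros, so the modulus of
    \<open>\<Psi>\<close> attains a positive minimum there.\<close>
  obtain \<delta> where \<delta>: "\<delta> > 0" "\<And>u. u \<in> \<Gamma> \<Longrightarrow> norm (\<Psi> u) \<ge> \<delta>"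
  proof -
    have "compact \<Gamma>" unfolding \<Gamma>_def by (intro compact_UN) auto
    moreover have "\<Gamma> \<noteq> {}"
    proof -
      have "s 0 + of_real r \<in> sphere (s 0) r" using r0 by (simp add: dist_norm)
      then show ?thesis using N unfolding \<Gamma>_def by blast
    qed
    moreover have "continuous_on \<Gamma> (\<lambda>u. norm (\<Psi> u))"
      unfolding \<Psi>_def by (intro continuous_intros)
    ultimately obtain u0 where "u0 \<in> \<Gamma>" "\<And>u. u \<in> \<Gamma> \<Longrightarrow> norm (\<Psi> u0) \<le> norm (\<Psi> u)"
      using continuous_attains_inf[of \<Gamma> "\<lambda>u. norm (\<Psi> u)"] by blast
    then show ?thesis using \<Psi>_nz that[of "norm (\<Psi> u0)"] by auto
  qed
  \<comment> \<open>The factor 2 * exp 2 / M bounds the modulus of 1 - z and enters twice, through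
    \<open>F\<close> and through Abel summation. The powers of \<open>M\<close> cancel: sqrt M *
    M^(3/2) / M^2 = 1.\<close>
  define B where "B = K * (2 * exp 2)\<^sup>2"
  have B0: "B > 0" using K by (simp add: B_def)
  define c where "c = 3 * B / \<delta>"
  define P where "P = smult (of_real c) P0"
  have c: "c > 0" "c * \<delta> = 3 * B" using B0 \<delta> by (auto simp: c_def)
  show ?thesis
  proof (rule that[of P])
    fix M :: nat and x :: "nat \<Rightarrow> complex"
    assume M: "M > 0" and gr: "growth M (\<lambda>k. x k - block_coeffs P M k) \<le> ennreal (K * M powr (3/2))"
    define q where "q = exp (- 1 / (2 * real M))"
    define Z where "Z u = exp (- u / of_nat M)" for u :: complex
    have q1: "q < 1" using M by (simp add: q_def)
    have fin: "growth M (\<lambda>k. x k - block_coeffs P M k) < \<infinity>" using gr by (simp add: le_less_trans)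
    have gr': "enn2real (growth M (\<lambda>k. x k - block_coeffs P M k)) \<le> K * M powr (3/2)"
      using gr K by (simp add: enn2real_leI)
    have Zq: "norm (Z u) < q" if "norm (u - 1) < 1/8" for u
      using re(1)[OF that] M by (simp add: Z_def q_def field_simps)
    have ZM: "Z u ^ M = exp (- u)" for u
      using M by (simp add: Z_def flip: exp_of_nat_mult)
    have Z1: "norm (1 - Z u) \<le> 2 * exp 2 / M" if "norm (u - 1) < 1/8" for u
    proof -
      have u2: "norm u \<le> 2" using re(2)[OF that] .
      have "norm (u / of_nat M) \<le> norm u" using M mult_right_mono[of 1 "real M" "norm u"] by (simp add: norm_divide field_simps)
      then have "\<bar>Re (- u / of_nat M)\<bar> \<le> 2" using abs_Re_le_cmod[of "- u / of_nat M"] u2 by simp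
      then have "exp \<bar>Re (- u / of_nat M)\<bar> * norm (- u / of_nat M) \<le> exp 2 * (2 / M)"
        using u2 by (intro mult_mono) (auto simp: norm_divide divide_right_mono)
      then show ?thesis using norm_exp_minus_one_le[of "- u / of_nat M"]
        by (simp add: Z_def norm_minus_commute mult.commute)
    qed
    have summ: "summable (\<lambda>k. x k * z ^ k)" if "norm z \<le> q" for z
    proof -
      have "summable (\<lambda>k. (x k - block_coeffs P M k) * z ^ k + block_coeffs P M k * z ^ k)"
        using that by (intro summable_add power_series_growth(1)[OF fin] sums_summable[OF block_coeffs_sums[OF M]])
          (simp add: q_def)
      then show ?thesis by (simp add: algebra_simps)
    qed
    have split: "gaf_disc x z = gaf_disc (\<lambda>k. x k - block_coeffs P M k) z
        + poly P (z ^ M) * (\<Sum>j<M. z ^ j) / of_real (sqrt M)" if "norm z \<le> q" for z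
    proof -
      have "(\<lambda>k. (x k - block_coeffs P M k) * z ^ k) sums gaf_disc (\<lambda>k. x k - block_coeffs P M k) z"
        unfolding gaf_disc_def using that
        by (intro summable_sums power_series_growth(1)[OF fin]) (simp add: q_def)
      from sums_add[OF this block_coeffs_sums[OF M, of P z]]
      show ?thesis unfolding gaf_disc_def[of x] by (simp add: algebra_simps sums_iff)
    qed
    have hol: "gaf_disc x holomorphic_on ball 0 q"
      by (rule power_series_holomorphic[where a=x]) (use summ in \<open>auto simp: gaf_disc_def intro!: summable_sums\<close>)
    \<comment> \<open>The factor (1 - z) * sqrt M clears the denominators of the block series,
      leaving a main term independent of \<open>M\<close>.\<close>
    define F where "F u = (1 - Z u) * of_real (sqrt M) * gaf_disc x (Z u)" for u
    have F_eq: "norm (F u - of_real c * \<Psi> u) \<le> B" if "norm (u - 1) < 1/8" for u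
    proof -
      define D where "D = gaf_disc (\<lambda>k. x k - block_coeffs P M k) (Z u)"
      have zq: "norm (Z u) \<le> q" using Zq[OF that] by simp
      have z1: "1 - Z u \<noteq> 0" using zq q1 by auto
      define G where "G = (\<Sum>j<M. Z u ^ j)"
      define \<mu> where "\<mu> = complex_of_real (sqrt M)"
      have \<mu>: "\<mu> \<noteq> 0" using M by (simp add: \<mu>_def)
      have polyP: "poly P w = of_real c * poly P0 w" for w by (simp add: P_def)
      have "F u = (1 - Z u) * \<mu> * (D + of_real c * poly P0 (exp (- u)) * G / \<mu>)"
        unfolding F_def split[OF zq] D_def[symmetric] ZM polyP G_def \<mu>_def ..
      also have "\<dots> = (1 - Z u) * \<mu> * D + of_real c * poly P0 (exp (- u)) * ((1 - Z u) * G)"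
        using \<mu> by (simp add: field_simps)
      also have "(1 - Z u) * G = 1 - exp (- u)"
        unfolding G_def ZM[symmetric] by (rule one_diff_power_eq[symmetric])
      finally have "F u - of_real c * \<Psi> u = (1 - Z u) * of_real (sqrt M) * D"
        by (simp add: \<Psi>_def \<mu>_def mult.assoc)
      then have "norm (F u - of_real c * \<Psi> u) = norm (1 - Z u) * sqrt M * norm D"
        by (simp add: norm_mult)
      also have "\<dots> \<le> (2 * exp 2 / M) * sqrt M * ((2 * exp 2 / M) * (K * M powr (3/2)))"
      proof (intro mult_mono Z1[OF that] order_refl)
        have "norm D \<le> norm (1 - Z u) * enn2real (growth M (\<lambda>k. x k - block_coeffs P M k))"
          unfolding D_def gaf_disc_def using zq by (intro power_series_growth(2)[OF fin]) (simp add: q_def)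
        also have "\<dots> \<le> (2 * exp 2 / M) * (K * M powr (3/2))"
          using gr' Z1[OF that] by (intro mult_mono) auto
        finally show "norm D \<le> (2 * exp 2 / M) * (K * M powr (3/2))" .
      qed (use K in auto)
      also have "\<dots> = B * (sqrt M * M powr (3/2)) / M\<^sup>2"
        by (simp add: B_def power2_eq_square)
      also have "sqrt M * M powr (3/2) = M\<^sup>2"
        using M by (simp add: powr_half_sqrt[symmetric] flip: powr_add powr_numeral)
      finally show ?thesis using M by simp
    qed
    have "\<exists>u\<in>ball (s i) r. F u = 0" if i: "i < N" for i
    proof -
      have holF: "F holomorphic_on ball (s i) r" and contF: "continuous_on (cball (s i) r) F"
      proof -
        have Zin: "Z u \<in> ball 0 q" if "u \<in> cball (s i) r" for u
          using Zq[OF near8[OF that i]] by simp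
        have "(\<lambda>u. gaf_disc x (Z u)) holomorphic_on ball (s i) r"
          by (rule holomorphic_on_compose_gen[OF _ hol, unfolded o_def])
             (use Zin M in \<open>auto simp: Z_def intro!: holomorphic_intros\<close>)
        then show "F holomorphic_on ball (s i) r"
          unfolding F_def Z_def using M by (intro holomorphic_intros) auto
        have "continuous_on (cball (s i) r) (\<lambda>u. gaf_disc x (Z u))"
          by (rule continuous_on_compose2[OF holomorphic_on_imp_continuous_on[OF hol]])
             (use Zin M in \<open>auto simp: Z_def intro!: continuous_intros\<close>)
        then show "continuous_on (cball (s i) r) F"
          unfolding F_def Z_def using M by (intro continuous_intros) auto
      qed
      show ?thesis
      \<comment> \<open>Minimum principle: the modulus of \<open>F\<close> is at most B at the
        centre, where \<open>\<Psi>\<close> vanishes, and at least 3B - B = 2B on the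
        circle.\<close>
      proof (rule holomorphic_contract_to_zero[OF contF holF r0])
        fix u assume u: "norm (s i - u) = r"
        have u\<Gamma>: "u \<in> \<Gamma>" using u i by (auto simp: \<Gamma>_def dist_norm)
        have "norm (F (s i)) \<le> B"
          using F_eq[OF near8[of "s i" i]] i r0 \<Psi>_zero[OF i] by simp
        moreover have "norm (F u - of_real c * \<Psi> u) \<le> B"
          using F_eq[OF near8[of u i]] i u by (simp add: dist_norm)
        moreover have "norm (of_real c * \<Psi> u) \<ge> 3 * B"
          using \<delta>(2)[OF u\<Gamma>] c by (simp add: norm_mult flip: c(2))
        moreover have "norm (of_real c * \<Psi> u) \<le> norm (F u) + norm (F u - of_real c * \<Psi> u)" by norm
        ultimately show "norm (F (s i)) < norm (F u)" using B0 by linarith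
      qed auto
    qed
    then obtain \<sigma> where \<sigma>: "\<And>i. i < N \<Longrightarrow> \<sigma> i \<in> ball (s i) r" "\<And>i. i < N \<Longrightarrow> F (\<sigma> i) = 0" by metis
    have \<sigma>8: "norm (\<sigma> i - 1) < 1/8" and \<sigma>N: "norm (\<sigma> i - 1) < 1/(8 * N)" if "i < N" for i
      using near8[of "\<sigma> i" i] near[of "\<sigma> i" i] \<sigma>(1)[OF that] that by auto
    \<comment> \<open>The image of u = 1, around which all the discs lie.\<close>
    define \<rho> where "\<rho> = exp (- 1 / real M)"
    have \<rho>: "\<rho> \<in> {0<..<1}" using M by (simp add: \<rho>_def)
    have \<rho>2: "1 - \<rho> \<ge> 1 / (2 * M)"
      using one_minus_exp_ge[of "1 / M"] M by (simp add: \<rho>_def)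
    define S where "S = (\<lambda>i. Z (\<sigma> i)) ` {..<N}"
    have "inj_on (\<lambda>i. Z (\<sigma> i)) {..<N}"
    proof (rule inj_onI)
      fix i j assume ij: "i \<in> {..<N}" "j \<in> {..<N}" "Z (\<sigma> i) = Z (\<sigma> j)"
      then have "exp (- \<sigma> i) = exp (- \<sigma> j)" using ZM by metis
      then have e: "\<sigma> i = \<sigma> j" using exp_inj \<sigma>8 ij by auto
      have "norm (s i - s j) \<le> norm (s i - \<sigma> i) + norm (s j - \<sigma> j)" unfolding e by norm
      also have "\<dots> < 4 * r" using \<sigma>(1)[of i] \<sigma>(1)[of j] ij r0 by (simp add: dist_norm)
      finally show "i = j" using sep[of i j] by linarith
    qed
    then have card: "finite S" "card S = N" by (auto simp: S_def card_image)
    have sub: "S \<subseteq> gaf_zeros x \<inter> ball (of_real \<rho>) ((1 - \<rho>) / N)"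
    proof
      fix z assume "z \<in> S"
      then obtain i where i: "i < N" "z = Z (\<sigma> i)" by (auto simp: S_def)
      have z1: "norm z < 1" using Zq[OF \<sigma>8[OF i(1)]] q1 i(2) by simp
      then have "1 - z \<noteq> 0" by auto
      then have "gaf_disc x z = 0" using \<sigma>(2)[OF i(1)] M by (auto simp: F_def i(2))
      then have "z \<in> gaf_zeros x" using z1 by (simp add: gaf_zeros_def)
      \<comment> \<open>Then z = \<rho> exp v with v smaller than 1/(8 N M), so z is within 3/(8 N
        M) of \<rho>, less than (1 - \<rho>)/N because 1 - \<rho> is at least 1/(2M).\<close>
      define v where "v = - (\<sigma> i - 1) / of_nat M"
      have nv: "norm v < 1 / (8 * real N * real M)"
        using \<sigma>N[OF i(1)] M N by (simp add: v_def norm_divide field_simps norm_minus_commute)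
      also have "1 / (8 * real N * real M) \<le> 1"
      proof -
        have "1 \<le> real N * real M" using M N by (simp flip: of_nat_mult)
        then have "1 \<le> 8 * real N * real M" by simp
        then show ?thesis using M N by (simp only: divide_le_eq_1) simp
      qed
      finally have v1: "\<bar>Re v\<bar> \<le> 1" using abs_Re_le_cmod[of v] by linarith
      have "z = of_real \<rho> * exp v"
      proof -
        have "complex_of_real \<rho> = exp (- 1 / of_nat M)" by (simp add: \<rho>_def flip: exp_of_real)
        then have "of_real \<rho> * exp v = exp (- 1 / of_nat M + v)" by (simp only: exp_add)
        also have "- 1 / of_nat M + v = - \<sigma> i / of_nat M"
          by (simp add: v_def diff_divide_distrib)
        finally show ?thesis by (simp add: i(2) Z_def)
      qed
      then have "z - of_real \<rho> = of_real \<rho> * (exp v - 1)" by (simp add: algebra_simps)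
      then have "norm (z - of_real \<rho>) = \<rho> * norm (exp v - 1)" using \<rho> by (simp add: norm_mult)
      also have "\<dots> \<le> 1 * (exp \<bar>Re v\<bar> * norm v)"
        using \<rho> norm_exp_minus_one_le[of v] by (intro mult_mono) auto
      also have "\<dots> \<le> 3 * norm v"
        using v1 exp_le by (simp, intro mult_right_mono) (auto intro: order_trans[of _ "exp 1"])
      also have "\<dots> < 3 * (1 / (8 * real N * real M))" using nv by simp
      also have "\<dots> \<le> (1 / (2 * M)) / N" using M N by (simp add: field_simps)
      also have "\<dots> \<le> (1 - \<rho>) / N" using \<rho>2 by (intro divide_right_mono) auto
      finally have "z \<in> ball (of_real \<rho>) ((1 - \<rho>) / N)" by (simp add: dist_norm norm_minus_commute)
      with \<open>z \<in> gaf_zeros x\<close> show "z \<in> gaf_zeros x \<inter> ball (of_real \<rho>) ((1 - \<rho>) / N)" by blast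
    qed
    show "\<exists>\<rho>\<in>{0<..<1}. \<exists>S. finite S \<and> card S = N \<and> S \<subseteq> gaf_zeros x \<inter> ball (of_real \<rho>) ((1 - \<rho>) / N)"
      using \<rho> card sub by blast
  qed
qed

subsection \<open>Gaussian sequences\<close>

definition gauss_measure :: "complex measure" where
  "gauss_measure = density lborel (\<lambda>z. ennreal (exp (- (cmod z)\<^sup>2) / pi))"

lemma sets_gauss_measure [simp, measurable_cong]: "sets gauss_measure = sets borel"
  by (simp add: gauss_measure_def)

lemma space_gauss_measure [simp]: "space gauss_measure = UNIV"
  by (simp add: gauss_measure_def)

lemma distr_std_complex_gaussian:
  assumes "std_complex_gaussian M X"
  shows "X \<in> borel_measurable M" "distr M borel X = gauss_measure"
proof -
  have "X \<in> measurable M lborel" and d: "distr M lborel X = gauss_measure"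
    using assms unfolding std_complex_gaussian_def distributed_def gauss_measure_def by auto
  then show [measurable]: "X \<in> borel_measurable M" by simp
  have "distr M borel X = distr M lborel X" by (rule distr_cong) auto
  with d show "distr M borel X = gauss_measure" by simp
qed

text \<open>The Cameron-Martin formula in one coordinate: Lebesgue measure is translation invariant,
  and the quotient of the shifted by the original Gaussian density is the exponential on the
  right.\<close>

lemma nn_integral_gauss_measure_shift:
  assumes [measurable]: "\<phi> \<in> borel_measurable borel"
  shows "(\<integral>\<^sup>+z. \<phi> (z - a) \<partial>gauss_measure) =
    (\<integral>\<^sup>+z. \<phi> z * ennreal (exp (- 2 * Re (cnj a * z) - (cmod a)\<^sup>2)) \<partial>gauss_measure)"
proof -
  have sq: "(cmod (z + a))\<^sup>2 = (cmod z)\<^sup>2 + 2 * Re (cnj a * z) + (cmod a)\<^sup>2" for z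
    by (simp only: cmod_power2) (simp add: power2_eq_square algebra_simps)
  have "(\<integral>\<^sup>+z. \<phi> (z - a) \<partial>gauss_measure) =
     (\<integral>\<^sup>+z. ennreal (exp (- (cmod z)\<^sup>2) / pi) * \<phi> (z - a) \<partial>lborel)"
    unfolding gauss_measure_def by (rule nn_integral_density) auto
  also have "\<dots> = (\<integral>\<^sup>+z. ennreal (exp (- (cmod z)\<^sup>2) / pi) * \<phi> (z - a) \<partial>distr lborel borel (\<lambda>z. a + z))"
    by (simp add: lborel_distr_plus)
  also have "\<dots> = (\<integral>\<^sup>+z. ennreal (exp (- (cmod (z + a))\<^sup>2) / pi) * \<phi> z \<partial>lborel)"
    by (subst nn_integral_distr) (auto simp: add.commute)
  also have "\<dots> = (\<integral>\<^sup>+z. ennreal (exp (- (cmod z)\<^sup>2) / pi) *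
      (\<phi> z * ennreal (exp (- 2 * Re (cnj a * z) - (cmod a)\<^sup>2))) \<partial>lborel)"
  proof (intro nn_integral_cong)
    fix z
    have "exp (- (cmod (z + a))\<^sup>2) / pi = exp (- (cmod z)\<^sup>2) / pi * exp (- 2 * Re (cnj a * z) - (cmod a)\<^sup>2)"
      unfolding sq by (simp flip: exp_add add: algebra_simps)
    note e = this
    have g: "ennreal (x * y) * p = ennreal x * (p * ennreal y)" if "x \<ge> 0" "y \<ge> 0" for x y p
      using that by (simp add: ennreal_mult mult_ac)
    show "ennreal (exp (- (cmod (z + a))\<^sup>2) / pi) * \<phi> z = ennreal (exp (- (cmod z)\<^sup>2) / pi) *
      (\<phi> z * ennreal (exp (- 2 * Re (cnj a * z) - (cmod a)\<^sup>2)))"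
      by (simp only: e, rule g) auto
  qed
  also have "\<dots> = (\<integral>\<^sup>+z. \<phi> z * ennreal (exp (- 2 * Re (cnj a * z) - (cmod a)\<^sup>2)) \<partial>gauss_measure)"
    unfolding gauss_measure_def by (rule nn_integral_density[symmetric]) auto
  finally show ?thesis .
qed

lemma nn_integral_gauss_measure_power2:
  assumes "prob_space gauss_measure"
  shows "(\<integral>\<^sup>+z. ennreal ((cmod z)\<^sup>2) \<partial>gauss_measure) \<le> 2"
proof -
  have "emeasure gauss_measure UNIV = 1" using prob_space.emeasure_space_1[OF assms] by simp
  then have mass: "(\<integral>\<^sup>+z. ennreal (exp (- (cmod z)\<^sup>2) / pi) \<partial>lborel) = 1"
    unfolding gauss_measure_def by (subst (asm) emeasure_density) auto
  have "(\<integral>\<^sup>+z. ennreal ((cmod z)\<^sup>2) \<partial>gauss_measure)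
      = (\<integral>\<^sup>+z. ennreal (exp (- (cmod z)\<^sup>2) / pi) * ennreal ((cmod z)\<^sup>2) \<partial>lborel)"
    unfolding gauss_measure_def by (rule nn_integral_density) auto
  also have "\<dots> \<le> (\<integral>\<^sup>+z. ennreal (exp (- (cmod z)\<^sup>2 / 2) / pi) \<partial>lborel)"
  proof (intro nn_integral_mono)
    fix z :: complex
    \<comment> \<open>With \<open>2 t e\<^sup>-\<^sup>2\<^sup>t \<le> e\<^sup>-\<^sup>t\<close> the second moment reduces to the total mass after rescaling.\<close>
    define t where "t = (cmod z)\<^sup>2 / 2"
    have "t \<ge> 0" by (simp add: t_def)
    have "t + t \<le> exp t"
    proof -
      have "1 + t + t\<^sup>2 / 2 \<le> exp t" using \<open>t \<ge> 0\<close> by (rule exp_lower_Taylor_quadratic)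
      moreover have "0 \<le> (t - 1)\<^sup>2" by simp
      ultimately show ?thesis by (simp add: power2_eq_square algebra_simps)
    qed
    then have "exp (- (t + t)) * (t + t) \<le> exp (- (t + t)) * exp t" by (intro mult_left_mono) auto
    also have "\<dots> = exp (- t)" by (simp flip: exp_add)
    finally have "exp (- (cmod z)\<^sup>2) * (cmod z)\<^sup>2 \<le> exp (- (cmod z)\<^sup>2 / 2)" by (simp add: t_def)
    then have "exp (- (cmod z)\<^sup>2) / pi * (cmod z)\<^sup>2 \<le> exp (- (cmod z)\<^sup>2 / 2) / pi"
      by (simp add: divide_right_mono)
    then show "ennreal (exp (- (cmod z)\<^sup>2) / pi) * ennreal ((cmod z)\<^sup>2) \<le> ennreal (exp (- (cmod z)\<^sup>2 / 2) / pi)"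
      by (simp flip: ennreal_mult)
  qed
  also have "\<dots> = 2 * (\<integral>\<^sup>+z. ennreal (exp (- (cmod z)\<^sup>2) / pi) \<partial>lborel)"
    by (subst lborel_affine[of "sqrt 2" 0])
       (simp_all add: nn_integral_density nn_integral_distr nn_integral_cmult power_mult_distrib)
  finally show ?thesis by (simp add: mass)
qed

lemma growth_measurable:
  assumes [measurable]: "\<And>k. x k \<in> borel_measurable N"
  shows "(\<lambda>\<omega>. growth M (\<lambda>k. x k \<omega>)) \<in> borel_measurable N"
  unfolding growth_def by measurable

text \<open>Each coefficient of \<open>P\<close> occurs \<open>M\<close> times with squared factor
  1/M. This makes the Cameron-Martin bounds uniform in \<open>M\<close>.\<close>

lemma block_coeffs_sum_power2:
  assumes M: "M > 0"
  shows "(\<Sum>k<Suc (degree P) * M. (cmod (block_coeffs P M k))\<^sup>2) = (\<Sum>i\<le>degree P. (cmod (coeff P i))\<^sup>2)"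
proof -
  have "(\<Sum>k<Suc (degree P) * M. (cmod (block_coeffs P M k))\<^sup>2) =
     (\<Sum>i<Suc (degree P). \<Sum>k=i*M..<i*M+M. (cmod (block_coeffs P M k))\<^sup>2)" by (rule sum.nat_group[symmetric])
  also have "\<dots> = (\<Sum>i<Suc (degree P). \<Sum>k=i*M..<i*M+M. (cmod (coeff P i))\<^sup>2 / M)"
  proof (intro sum.cong refl)
    fix i k assume "k \<in> {i * M..<i * M + M}"
    then have "k div M = i" by (intro div_nat_eqI) (auto simp: mult.commute)
    then show "(cmod (block_coeffs P M k))\<^sup>2 = (cmod (coeff P i))\<^sup>2 / M"
      by (simp add: block_coeffs_def norm_divide power_divide)
  qed
  also have "\<dots> = (\<Sum>i\<le>degree P. (cmod (coeff P i))\<^sup>2)"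
    using M by (simp add: lessThan_Suc_atMost)
  finally show ?thesis .
qed

text \<open>The weight stands in for sqrt (n + 1), the order of an expected partial sum, and gives a
  geometric series and its derivative. With 1 / (1 - q) at most 4M these add up to (4 + 16)
  M^(3/2).\<close>

lemma growth_weights_sum:
  fixes M :: nat
  assumes M: "M > 0"
  shows "(\<Sum>n. ennreal ((sqrt M + Suc n / sqrt M) * exp (- 1 / (2 * real M)) ^ n)) \<le> ennreal (20 * M powr (3/2))"
proof -
  define q where "q = exp (- 1 / (2 * real M))"
  have q: "0 < q" "q < 1" using M by (auto simp: q_def)
  have q4: "1 - q \<ge> 1 / (4 * real M)" using one_minus_exp_ge[of "1 / (2 * real M)"] M by (simp add: q_def)
  then have inv: "1 / (1 - q) \<le> 4 * real M" using q M by (simp add: field_simps)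
  have "(\<lambda>n. sqrt M * q ^ n + 1 / sqrt M * (of_nat (Suc n) * q ^ n)) sums
     (sqrt M * (1 / (1 - q)) + 1 / sqrt M * (1 / (1 - q)\<^sup>2))"
    using q by (intro sums_add sums_mult geometric_sums geometric_deriv_sums) auto
  then have s: "(\<lambda>n. (sqrt M + Suc n / sqrt M) * q ^ n) sums
     (sqrt M * (1 / (1 - q)) + 1 / sqrt M * (1 / (1 - q)\<^sup>2))"
    by (simp add: algebra_simps add_divide_distrib)
  have "(\<Sum>n. ennreal ((sqrt M + Suc n / sqrt M) * q ^ n)) =
     ennreal (sqrt M * (1 / (1 - q)) + 1 / sqrt M * (1 / (1 - q)\<^sup>2))"
    using sums_unique[OF s] sums_summable[OF s] q by (subst suminf_ennreal2) auto
  also have "\<dots> \<le> ennreal (20 * M powr (3/2))"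
  proof (rule ennreal_leI)
    have m: "M powr (3/2) = real M * sqrt M"
      using M by (simp add: powr_half_sqrt[symmetric] powr_mult_base)
    have "(1 / (1 - q))\<^sup>2 \<le> (4 * real M)\<^sup>2" using inv q by (intro power_mono) auto
    then have "sqrt M * (1 / (1 - q)) + 1 / sqrt M * (1 / (1 - q))\<^sup>2
        \<le> sqrt M * (4 * real M) + 1 / sqrt M * (4 * real M)\<^sup>2"
      using inv by (intro add_mono mult_left_mono) auto
    also have "(4 * real M)\<^sup>2 = 16 * real M * (sqrt M * sqrt M)" by (simp add: power2_eq_square)
    also have "sqrt M * (4 * real M) + 1 / sqrt M * (16 * real M * (sqrt M * sqrt M)) = 20 * M powr (3/2)"
    proof -
      have "r * (4 * m) + 1 / r * (16 * m * (r * r)) = 20 * (m * r)" if "r \<noteq> 0" for r m :: real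
        using that by (simp add: field_simps)
      then show ?thesis unfolding m by this (use M in simp)
    qed
    finally show "sqrt M * (1 / (1 - q)) + 1 / sqrt M * (1 / (1 - q)\<^sup>2) \<le> 20 * M powr (3/2)"
      by (simp add: power_divide)
  qed
  finally show ?thesis by (simp add: q_def)
qed

section \<open>Second moments and the expected growth of a Gaussian sequence\<close>

locale gaussian_sequence = prob_space +
  fixes f :: "nat \<Rightarrow> 'a \<Rightarrow> complex"
  assumes indep: "indep_vars (\<lambda>_. borel) f UNIV"
    and gaussian: "\<And>n. std_complex_gaussian M (f n)"
begin

lemma f_measurable [measurable]: "f n \<in> borel_measurable M"
  using distr_std_complex_gaussian(1)[OF gaussian] .

lemma prob_space_gauss_measure: "prob_space gauss_measure"
  using prob_space_distr[OF f_measurable[of 0]] distr_std_complex_gaussian(2)[OF gaussian[of 0]] by simp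

lemma nn_integral_power2: "(\<integral>\<^sup>+\<omega>. ennreal ((cmod (f n \<omega>))\<^sup>2) \<partial>M) \<le> 2"
proof -
  have "(\<integral>\<^sup>+\<omega>. ennreal ((cmod (f n \<omega>))\<^sup>2) \<partial>M) = (\<integral>\<^sup>+z. ennreal ((cmod z)\<^sup>2) \<partial>distr M borel (f n))"
    by (subst nn_integral_distr) auto
  then show ?thesis
    using nn_integral_gauss_measure_power2[OF prob_space_gauss_measure]
    by (simp add: distr_std_complex_gaussian(2)[OF gaussian])
qed

lemma integrable_power2: "integrable M (\<lambda>\<omega>. (cmod (f n \<omega>))\<^sup>2)"
  by (rule integrableI_bounded) (use nn_integral_power2[of n] in \<open>auto simp: order_le_less_trans\<close>)

lemma integrable_f: "integrable M (f n)"
proof (rule Bochner_Integration.integrable_bound[OF Bochner_Integration.integrable_add[OF integrable_const[of 1] integrable_power2[of n]]])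
  have "cmod z \<le> 1 + (cmod z)\<^sup>2" for z :: complex
    using zero_le_power2[of "cmod z - 1"] by (simp add: power2_eq_square algebra_simps) (smt (verit) norm_ge_zero zero_le_square)
  then show "AE \<omega> in M. norm (f n \<omega>) \<le> norm (1 + (cmod (f n \<omega>))\<^sup>2)" by auto
qed simp

lemma expectation_power2_le: "(\<integral>\<omega>. (cmod (f n \<omega>))\<^sup>2 \<partial>M) \<le> 2"
  using nn_integral_power2[of n] nn_integral_eq_integral[OF integrable_power2[of n]]
  by (simp flip: ennreal_numeral)

text \<open>The density is even, so the reflection of the plane at 0 turns the integral into its
  negative.\<close>

lemma expectation_f: "(\<integral>\<omega>. f n \<omega> \<partial>M) = 0"
proof -
  have "(\<integral>\<omega>. f n \<omega> \<partial>M) = (\<integral>z. z \<partial>distr M borel (f n))" by (subst integral_distr) auto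
  also have "\<dots> = (\<integral>z. (exp (- (cmod z)\<^sup>2) / pi) *\<^sub>R z \<partial>lborel)"
    unfolding distr_std_complex_gaussian(2)[OF gaussian] gauss_measure_def
    by (subst integral_density) auto
  also have "\<dots> = 0"
  proof -
    have l: "(lborel :: complex measure) = distr lborel borel uminus"
      using lborel_affine[of "-1" "0::complex"] by (simp add: density_1)
    have "(\<integral>z. (exp (- (cmod z)\<^sup>2) / pi) *\<^sub>R z \<partial>lborel) = (\<integral>z. (exp (- (cmod z)\<^sup>2) / pi) *\<^sub>R z \<partial>distr lborel borel uminus)"
      using l by simp
    also have "\<dots> = (\<integral>z. - ((exp (- (cmod z)\<^sup>2) / pi) *\<^sub>R z) \<partial>lborel)"
      by (subst integral_distr) auto
    also have "\<dots> = - (\<integral>z. (exp (- (cmod z)\<^sup>2) / pi) *\<^sub>R z \<partial>lborel)" by simp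
    finally show ?thesis by (simp add: equal_neg_zero)
  qed
  finally show ?thesis .
qed

lemma orthogonal:
  assumes "j \<noteq> k"
  shows "integrable M (\<lambda>\<omega>. f j \<omega> * cnj (f k \<omega>))" "(\<integral>\<omega>. f j \<omega> * cnj (f k \<omega>) \<partial>M) = 0"
proof -
  define X where "X i \<omega> = (if i = k then cnj (f i \<omega>) else f i \<omega>)" for i \<omega>
  have "indep_vars (\<lambda>_. borel) (\<lambda>i \<omega>. (if i = k then cnj else id) (f i \<omega>)) {j, k}"
    by (rule indep_vars_compose2[OF indep_vars_subset[OF indep]])
       (auto intro!: borel_measurable_continuous_onI continuous_intros)
  also have "(\<lambda>i \<omega>. (if i = k then cnj else id) (f i \<omega>)) = X" by (auto simp: X_def fun_eq_iff)
  finally have ind: "indep_vars (\<lambda>_. borel) X {j, k}" .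
  have int: "integrable M (X i)" for i
    unfolding X_def by (cases "i = k") (auto intro: integrable_f)
  have prod: "(\<Prod>i\<in>{j,k}. X i \<omega>) = f j \<omega> * cnj (f k \<omega>)" for \<omega>
    using assms by (simp add: X_def)
  show "integrable M (\<lambda>\<omega>. f j \<omega> * cnj (f k \<omega>))"
    using indep_vars_integrable[OF _ ind int] unfolding prod by simp
  have "(\<integral>\<omega>. (\<Prod>i\<in>{j,k}. X i \<omega>) \<partial>M) = (\<Prod>i\<in>{j,k}. \<integral>\<omega>. X i \<omega> \<partial>M)"
    by (rule indep_vars_lebesgue_integral) (use ind int in auto)
  also have "\<dots> = 0" using assms expectation_f by (auto simp: X_def)
  finally show "(\<integral>\<omega>. f j \<omega> * cnj (f k \<omega>) \<partial>M) = 0" unfolding prod .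
qed

text \<open>Expanding the square, the off-diagonal terms vanish by independence and mean zero; each
  diagonal second moment is at most 2.\<close>

lemma expectation_norm_sum_power2:
  fixes a :: "nat \<Rightarrow> complex"
  assumes fin: "finite J"
  shows "integrable M (\<lambda>\<omega>. (cmod (\<Sum>k\<in>J. a k * f k \<omega>))\<^sup>2)"
    and "(\<integral>\<omega>. (cmod (\<Sum>k\<in>J. a k * f k \<omega>))\<^sup>2 \<partial>M) \<le> 2 * (\<Sum>k\<in>J. (cmod (a k))\<^sup>2)"
proof -
  have eq: "complex_of_real ((cmod (\<Sum>k\<in>J. a k * f k \<omega>))\<^sup>2) =
      (\<Sum>j\<in>J. \<Sum>k\<in>J. a j * cnj (a k) * (f j \<omega> * cnj (f k \<omega>)))" for \<omega>
    unfolding complex_norm_square cnj_sum sum_product by (intro sum.cong refl) (simp add: mult_ac)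
  have diag: "f k \<omega> * cnj (f k \<omega>) = complex_of_real ((cmod (f k \<omega>))\<^sup>2)" for k \<omega>
    by (rule complex_norm_square[symmetric])
  have int: "integrable M (\<lambda>\<omega>. f j \<omega> * cnj (f k \<omega>))" for j k
    using orthogonal(1)[of j k] integrable_power2[of k] by (cases "j = k") (auto simp only: diag intro: integrable_of_real)
  have "integrable M (\<lambda>\<omega>. complex_of_real ((cmod (\<Sum>k\<in>J. a k * f k \<omega>))\<^sup>2))"
    unfolding eq by (intro Bochner_Integration.integrable_sum integrable_mult_right int)
  from integrable_norm[OF this] show int2: "integrable M (\<lambda>\<omega>. (cmod (\<Sum>k\<in>J. a k * f k \<omega>))\<^sup>2)"
    by (simp only: norm_of_real abs_power2)
  have "complex_of_real (\<integral>\<omega>. (cmod (\<Sum>k\<in>J. a k * f k \<omega>))\<^sup>2 \<partial>M) =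
     (\<integral>\<omega>. (\<Sum>j\<in>J. \<Sum>k\<in>J. a j * cnj (a k) * (f j \<omega> * cnj (f k \<omega>))) \<partial>M)"
    unfolding eq[symmetric] by (simp only: integral_complex_of_real)
  also have "\<dots> = (\<Sum>j\<in>J. \<Sum>k\<in>J. a j * cnj (a k) * (\<integral>\<omega>. f j \<omega> * cnj (f k \<omega>) \<partial>M))"
    by (simp add: int Bochner_Integration.integral_sum)
  also have "\<dots> = (\<Sum>j\<in>J. \<Sum>k\<in>J. if j = k then complex_of_real ((cmod (a k))\<^sup>2 * (\<integral>\<omega>. (cmod (f k \<omega>))\<^sup>2 \<partial>M)) else 0)"
  proof (intro sum.cong refl)
    fix j k
    show "a j * cnj (a k) * (\<integral>\<omega>. f j \<omega> * cnj (f k \<omega>) \<partial>M) =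
      (if j = k then complex_of_real ((cmod (a k))\<^sup>2 * (\<integral>\<omega>. (cmod (f k \<omega>))\<^sup>2 \<partial>M)) else 0)"
    proof (cases "j = k")
      case True
      then show ?thesis
        by (simp only: diag integral_complex_of_real simp_thms if_True of_real_mult complex_norm_square[symmetric])
    qed (simp add: orthogonal)
  qed
  also have "\<dots> = complex_of_real (\<Sum>k\<in>J. (cmod (a k))\<^sup>2 * (\<integral>\<omega>. (cmod (f k \<omega>))\<^sup>2 \<partial>M))"
    using fin by (simp add: sum.delta)
  finally have "(\<integral>\<omega>. (cmod (\<Sum>k\<in>J. a k * f k \<omega>))\<^sup>2 \<partial>M) = (\<Sum>k\<in>J. (cmod (a k))\<^sup>2 * (\<integral>\<omega>. (cmod (f k \<omega>))\<^sup>2 \<partial>M))"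
    by (simp only: of_real_eq_iff)
  also have "\<dots> \<le> (\<Sum>k\<in>J. (cmod (a k))\<^sup>2 * 2)"
    by (intro sum_mono mult_left_mono expectation_power2_le) auto
  finally show "(\<integral>\<omega>. (cmod (\<Sum>k\<in>J. a k * f k \<omega>))\<^sup>2 \<partial>M) \<le> 2 * (\<Sum>k\<in>J. (cmod (a k))\<^sup>2)"
    by (simp add: sum_distrib_left mult.commute)
qed

text \<open>In place of Cauchy-Schwarz, s \<le> (\<kappa> + s^2/\<kappa>)/2 reduces the first moment
  to the second one.\<close>

lemma nn_integral_norm_sum_le:
  fixes a :: "nat \<Rightarrow> complex"
  assumes fin: "finite J" and \<kappa>: "\<kappa> > 0" "2 * (\<Sum>k\<in>J. (cmod (a k))\<^sup>2) \<le> \<kappa>\<^sup>2"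
  shows "(\<integral>\<^sup>+\<omega>. ennreal (cmod (\<Sum>k\<in>J. a k * f k \<omega>)) \<partial>M) \<le> ennreal \<kappa>"
proof -
  note E = expectation_norm_sum_power2[OF fin, of a]
  have am: "s \<le> (\<kappa> + s\<^sup>2 / \<kappa>) / 2" for s :: real
    using \<kappa>(1) zero_le_power2[of "s - \<kappa>"] by (simp add: field_simps power2_eq_square)
  have "(\<integral>\<^sup>+\<omega>. ennreal (cmod (\<Sum>k\<in>J. a k * f k \<omega>)) \<partial>M)
      \<le> (\<integral>\<^sup>+\<omega>. ennreal ((\<kappa> + (cmod (\<Sum>k\<in>J. a k * f k \<omega>))\<^sup>2 / \<kappa>) / 2) \<partial>M)"
    by (intro nn_integral_mono ennreal_leI am)
  also have "\<dots> = ennreal (\<integral>\<omega>. (\<kappa> + (cmod (\<Sum>k\<in>J. a k * f k \<omega>))\<^sup>2 / \<kappa>) / 2 \<partial>M)"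
    by (rule nn_integral_eq_integral) (use E(1) \<kappa> in auto)
  also have "(\<integral>\<omega>. (\<kappa> + (cmod (\<Sum>k\<in>J. a k * f k \<omega>))\<^sup>2 / \<kappa>) / 2 \<partial>M) =
      (\<kappa> + (\<integral>\<omega>. (cmod (\<Sum>k\<in>J. a k * f k \<omega>))\<^sup>2 \<partial>M) / \<kappa>) / 2"
    using E(1) by (simp add: prob_space)
  also have "\<dots> \<le> (\<kappa> + \<kappa>\<^sup>2 / \<kappa>) / 2"
    using E(2) \<kappa> by (intro divide_right_mono add_left_mono) auto
  also have "\<dots> = \<kappa>" using \<kappa> by (simp add: power2_eq_square)
  finally show ?thesis using \<kappa>(1) by (simp add: ennreal_leI)
qed

lemma nn_integral_growth_le:
  assumes M: "n > 0"
  shows "(\<integral>\<^sup>+\<omega>. growth n (\<lambda>k. f k \<omega>) \<partial>M) \<le> ennreal (20 * n powr (3/2))"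
proof -
  define q where "q = exp (- 1 / (2 * real n))"
  have q: "q \<ge> 0" by (simp add: q_def)
  have "(\<integral>\<^sup>+\<omega>. growth n (\<lambda>k. f k \<omega>) \<partial>M) = (\<Sum>m. \<integral>\<^sup>+\<omega>. ennreal (cmod (\<Sum>k\<le>m. f k \<omega>) * q ^ m) \<partial>M)"
    unfolding growth_def q_def by (rule nn_integral_suminf) measurable
  also have "\<dots> \<le> (\<Sum>m. ennreal ((sqrt n + Suc m / sqrt n) * q ^ m))"
  proof (intro suminf_le)
    fix m
    have "(\<integral>\<^sup>+\<omega>. ennreal (cmod (\<Sum>k\<le>m. 1 * f k \<omega>)) \<partial>M) \<le> ennreal (sqrt n + Suc m / sqrt n)"
    proof (rule nn_integral_norm_sum_le)
      show "0 < sqrt n + Suc m / sqrt n" using M by (intro add_pos_nonneg) auto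
      \<comment> \<open>The arithmetic-geometric mean inequality: the two summands have product m +
        1, so their sum has square at least 4 (m + 1), which exceeds the required 2 (m + 1).\<close>
      have "0 \<le> (sqrt n - Suc m / sqrt n)\<^sup>2" by simp
      also have "\<dots> = (sqrt n + Suc m / sqrt n)\<^sup>2 - 4 * (sqrt n * (Suc m / sqrt n))"
        by (simp only: power2_eq_square) algebra
      also have "sqrt n * (Suc m / sqrt n) = Suc m" using M by simp
      finally have "4 * real (Suc m) \<le> (sqrt n + Suc m / sqrt n)\<^sup>2" by simp
      then show "2 * (\<Sum>k\<le>m. (cmod 1)\<^sup>2) \<le> (sqrt n + Suc m / sqrt n)\<^sup>2" by simp
    qed simp
    then have "(\<integral>\<^sup>+\<omega>. ennreal (cmod (\<Sum>k\<le>m. f k \<omega>)) \<partial>M) * ennreal (q ^ m)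
       \<le> ennreal (sqrt n + Suc m / sqrt n) * ennreal (q ^ m)" by (intro mult_right_mono) auto
    then show "(\<integral>\<^sup>+\<omega>. ennreal (cmod (\<Sum>k\<le>m. f k \<omega>) * q ^ m) \<partial>M) \<le> ennreal ((sqrt n + Suc m / sqrt n) * q ^ m)"
      using q by (simp add: ennreal_mult nn_integral_multc)
  qed auto
  also have "\<dots> \<le> ennreal (20 * n powr (3/2))" unfolding q_def by (rule growth_weights_sum[OF M])
  finally show ?thesis .
qed

end

section \<open>The Cameron-Martin formula for finitely many coordinates of the sequence
  space\<close>

abbreviation gauss_seq :: "(nat \<Rightarrow> complex) measure" where
  "gauss_seq \<equiv> PiM UNIV (\<lambda>_. gauss_measure)"

lemma measurable_into_sequences:
  assumes "\<And>i. (\<lambda>\<omega>. F \<omega> i) \<in> borel_measurable N"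
  shows "F \<in> N \<rightarrow>\<^sub>M PiM UNIV (\<lambda>_. borel)"
  using measurable_PiM_single'[of UNIV "\<lambda>i \<omega>. F \<omega> i" N "\<lambda>_. borel"] assms by simp

text \<open>The product measure is unchanged when coordinate \<open>j\<close> is replaced by an
  independent Gaussian \<open>u\<close>. Integrating over \<open>u\<close> first reduces the claim
  to the formula in the plane.\<close>

lemma nn_integral_gauss_seq_shift1:
  assumes prob: "prob_space gauss_measure"
    and \<phi>[measurable]: "\<phi> \<in> borel_measurable (PiM UNIV (\<lambda>_. borel))"
  shows "(\<integral>\<^sup>+x. \<phi> (x(j := x j - a)) \<partial>gauss_seq) =
    (\<integral>\<^sup>+x. \<phi> x * ennreal (exp (- 2 * Re (cnj a * x j) - (cmod a)\<^sup>2)) \<partial>gauss_seq)"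
proof -
  interpret G: prob_space gauss_measure by fact
  interpret S: prob_space gauss_seq by (rule prob_space_PiM, rule prob)
  interpret P: pair_sigma_finite gauss_measure gauss_seq ..
  have sets_eq [measurable_cong]: "sets gauss_seq = sets (PiM UNIV (\<lambda>_. borel))"
    by (intro sets_PiM_cong) auto
  have D: "distr (gauss_measure \<Otimes>\<^sub>M gauss_seq) gauss_seq (\<lambda>(u, x). x(j := u)) = gauss_seq"
    using distr_pair_PiM_eq_PiM[of UNIV "\<lambda>_. gauss_measure" j] prob by (simp add: insert_UNIV)
  have upd: "(\<lambda>p. (snd p)(j := g p)) \<in> N \<Otimes>\<^sub>M gauss_seq \<rightarrow>\<^sub>M PiM UNIV (\<lambda>_. borel)"
    if [measurable]: "g \<in> borel_measurable (N \<Otimes>\<^sub>M gauss_seq)" for g and N :: "complex measure"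
  proof (rule measurable_into_sequences)
    fix i :: nat
    show "(\<lambda>p. ((snd p)(j := g p)) i) \<in> borel_measurable (N \<Otimes>\<^sub>M gauss_seq)"
      by (cases "i = j") (simp_all, measurable)
  qed
  have upd1 [measurable]: "(\<lambda>x. x(j := x j - a)) \<in> gauss_seq \<rightarrow>\<^sub>M PiM UNIV (\<lambda>_. borel)"
  proof (rule measurable_into_sequences)
    fix i :: nat
    show "(\<lambda>x. (x(j := x j - a)) i) \<in> borel_measurable gauss_seq"
      by (cases "i = j") (simp_all, measurable)
  qed
  have split: "(\<integral>\<^sup>+x. \<psi> x \<partial>gauss_seq) = (\<integral>\<^sup>+x. \<integral>\<^sup>+u. \<psi> (x(j := u)) \<partial>gauss_measure \<partial>gauss_seq)"
    if [measurable]: "\<psi> \<in> borel_measurable gauss_seq" for \<psi>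
  proof -
    have m: "(\<lambda>(u, x). x(j := u)) \<in> gauss_measure \<Otimes>\<^sub>M gauss_seq \<rightarrow>\<^sub>M gauss_seq"
      using upd[of fst gauss_measure] by (simp add: case_prod_beta' measurable_cong_sets[OF refl sets_eq])
    have "(\<integral>\<^sup>+x. \<psi> x \<partial>gauss_seq) = (\<integral>\<^sup>+p. \<psi> ((\<lambda>(u, x). x(j := u)) p) \<partial>(gauss_measure \<Otimes>\<^sub>M gauss_seq))"
      by (subst D[symmetric], rule nn_integral_distr[OF m]) simp
    also have "\<dots> = (\<integral>\<^sup>+x. \<integral>\<^sup>+u. \<psi> (x(j := u)) \<partial>gauss_measure \<partial>gauss_seq)"
      using measurable_compose[OF m that] by (subst P.nn_integral_snd[symmetric]) (auto simp: case_prod_beta')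
    finally show ?thesis .
  qed
  have "(\<integral>\<^sup>+x. \<phi> (x(j := x j - a)) \<partial>gauss_seq) = (\<integral>\<^sup>+x. \<integral>\<^sup>+u. \<phi> (x(j := u - a)) \<partial>gauss_measure \<partial>gauss_seq)"
    by (subst split) simp_all
  also have "\<dots> = (\<integral>\<^sup>+x. \<integral>\<^sup>+u. \<phi> (x(j := u)) * ennreal (exp (- 2 * Re (cnj a * u) - (cmod a)\<^sup>2)) \<partial>gauss_measure \<partial>gauss_seq)"
  proof (rule nn_integral_cong)
    fix x :: "nat \<Rightarrow> complex"
    have "(\<lambda>u. x(j := u)) \<in> borel \<rightarrow>\<^sub>M PiM UNIV (\<lambda>_. borel)"
    proof (rule measurable_into_sequences)
      fix i :: nat
      show "(\<lambda>u. (x(j := u)) i) \<in> borel_measurable borel"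
        by (cases "i = j") simp_all
    qed
    then have "(\<lambda>u. \<phi> (x(j := u))) \<in> borel_measurable borel" by simp
    then show "(\<integral>\<^sup>+u. \<phi> (x(j := u - a)) \<partial>gauss_measure) =
       (\<integral>\<^sup>+u. \<phi> (x(j := u)) * ennreal (exp (- 2 * Re (cnj a * u) - (cmod a)\<^sup>2)) \<partial>gauss_measure)"
      by (rule nn_integral_gauss_measure_shift)
  qed
  also have "\<dots> = (\<integral>\<^sup>+x. \<phi> x * ennreal (exp (- 2 * Re (cnj a * x j) - (cmod a)\<^sup>2)) \<partial>gauss_seq)"
    by (subst (2) split) simp_all
  finally show ?thesis .
qed

lemma nn_integral_gauss_seq_shift:
  assumes prob: "prob_space gauss_measure" and fin: "finite J"
    and \<phi>: "\<phi> \<in> borel_measurable (PiM UNIV (\<lambda>_. borel))"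
  shows "(\<integral>\<^sup>+x. \<phi> (\<lambda>k. if k \<in> J then x k - h k else x k) \<partial>gauss_seq) =
    (\<integral>\<^sup>+x. \<phi> x * (\<Prod>k\<in>J. ennreal (exp (- 2 * Re (cnj (h k) * x k) - (cmod (h k))\<^sup>2))) \<partial>gauss_seq)"
  using fin \<phi>
proof (induction J arbitrary: \<phi> rule: finite_induct)
  case (insert j J)
  note \<phi>[measurable] = insert.prems
  define w where "w k z = ennreal (exp (- 2 * Re (cnj (h k) * z) - (cmod (h k))\<^sup>2))" for k z
  have [measurable]: "w k \<in> borel_measurable borel" for k unfolding w_def by measurable
  \<comment> \<open>The shifts in \<open>J\<close> are absorbed into the integrand so that
    coordinate \<open>j\<close> is shifted alone. As \<open>j\<close> is not in \<open>J\<close>,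
    its weight is unaffected by the remaining shifts.\<close>
  define \<phi>' where "\<phi>' x = \<phi> (\<lambda>k. if k \<in> J then x k - h k else x k)" for x
  have "(\<lambda>x k. if k \<in> J then x k - h k else x k) \<in> PiM UNIV (\<lambda>_. borel) \<rightarrow>\<^sub>M PiM UNIV (\<lambda>_. borel)"
    by (rule measurable_into_sequences) (auto intro!: measurable_component_singleton borel_measurable_diff)
  then have [measurable]: "\<phi>' \<in> borel_measurable (PiM UNIV (\<lambda>_. borel))" unfolding \<phi>'_def by measurable
  have "(\<integral>\<^sup>+x. \<phi> (\<lambda>k. if k \<in> insert j J then x k - h k else x k) \<partial>gauss_seq) = (\<integral>\<^sup>+x. \<phi>' (x(j := x j - h j)) \<partial>gauss_seq)"
    unfolding \<phi>'_def using insert.hyps by (intro nn_integral_cong arg_cong[of _ _ \<phi>]) auto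
  also have "\<dots> = (\<integral>\<^sup>+x. \<phi>' x * w j (x j) \<partial>gauss_seq)"
    unfolding w_def by (rule nn_integral_gauss_seq_shift1[OF prob]) simp
  also have "\<dots> = (\<integral>\<^sup>+x. (\<lambda>y. \<phi> y * w j (y j)) (\<lambda>k. if k \<in> J then x k - h k else x k) \<partial>gauss_seq)"
    using insert.hyps by (simp add: \<phi>'_def)
  also have "\<dots> = (\<integral>\<^sup>+x. (\<phi> x * w j (x j)) * (\<Prod>k\<in>J. w k (x k)) \<partial>gauss_seq)"
    unfolding w_def[symmetric] by (subst insert.IH) (simp_all add: w_def)
  also have "\<dots> = (\<integral>\<^sup>+x. \<phi> x * (\<Prod>k\<in>insert j J. w k (x k)) \<partial>gauss_seq)"
    using insert.hyps by (simp add: mult.assoc)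
  finally show ?case unfolding w_def .
qed simp

context gaussian_sequence
begin

text \<open>Independence says that the joint law of the sequence is the product measure; this
  carries the shift formula back to \<open>M\<close>.\<close>

lemma nn_integral_gauss_seq:
  assumes [measurable]: "\<phi> \<in> borel_measurable (PiM UNIV (\<lambda>_. borel))"
  shows "(\<integral>\<^sup>+x. \<phi> x \<partial>gauss_seq) = (\<integral>\<^sup>+\<omega>. \<phi> (\<lambda>k. f k \<omega>) \<partial>M)"
proof -
  have "distr M (PiM UNIV (\<lambda>_. borel)) (\<lambda>\<omega>. \<lambda>k\<in>UNIV. f k \<omega>) = PiM UNIV (\<lambda>k. distr M borel (f k))"
    using indep_vars_iff_distr_eq_PiM[where I=UNIV and X=f and M'="\<lambda>_. borel"] indep by simp
  also have "\<dots> = gauss_seq" by (simp add: distr_std_complex_gaussian(2)[OF gaussian])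
  finally have d: "gauss_seq = distr M (PiM UNIV (\<lambda>_. borel)) (\<lambda>\<omega> k. f k \<omega>)" by (simp add: restrict_UNIV)
  have "(\<lambda>\<omega> k. f k \<omega>) \<in> M \<rightarrow>\<^sub>M PiM UNIV (\<lambda>_. borel)"
    by (rule measurable_into_sequences) simp
  then show ?thesis unfolding d by (subst nn_integral_distr) auto
qed

lemma markov_prob:
  assumes [measurable]: "\<phi> \<in> borel_measurable M" and "(\<integral>\<^sup>+\<omega>. \<phi> \<omega> \<partial>M) \<le> ennreal c" and c: "c > 0"
  shows "emeasure M {\<omega> \<in> space M. \<phi> \<omega> \<ge> ennreal (4 * c)} \<le> ennreal (1 / 4)"
proof -
  have "emeasure M {\<omega> \<in> space M. 1 \<le> ennreal (1 / (4 * c)) * \<phi> \<omega>}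
     \<le> ennreal (1 / (4 * c)) * (\<integral>\<^sup>+\<omega>. \<phi> \<omega> * indicator (space M) \<omega> \<partial>M)"
    using nn_integral_Markov_inequality[of \<phi> "space M" M "ennreal (1 / (4 * c))"] by (simp add: conj_commute)
  also have "(\<integral>\<^sup>+\<omega>. \<phi> \<omega> * indicator (space M) \<omega> \<partial>M) = (\<integral>\<^sup>+\<omega>. \<phi> \<omega> \<partial>M)"
    by (intro nn_integral_cong) auto
  also have "ennreal (1 / (4 * c)) * \<dots> \<le> ennreal (1 / (4 * c)) * ennreal c"
    by (intro mult_left_mono assms) auto
  also have "\<dots> = ennreal (1 / 4)" using c by (simp flip: ennreal_mult)
  finally have "emeasure M {\<omega> \<in> space M. 1 \<le> ennreal (1 / (4 * c)) * \<phi> \<omega>} \<le> ennreal (1 / 4)" .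
  note le = this
  have "{\<omega> \<in> space M. \<phi> \<omega> \<ge> ennreal (4 * c)} \<subseteq> {\<omega> \<in> space M. 1 \<le> ennreal (1 / (4 * c)) * \<phi> \<omega>}"
  proof safe
    fix \<omega> assume "ennreal (4 * c) \<le> \<phi> \<omega>"
    then have "ennreal (1 / (4 * c)) * ennreal (4 * c) \<le> ennreal (1 / (4 * c)) * \<phi> \<omega>"
      by (intro mult_left_mono) auto
    moreover have "ennreal (1 / (4 * c)) * ennreal (4 * c) = 1" using c by (simp flip: ennreal_mult)
    ultimately show "1 \<le> ennreal (1 / (4 * c)) * \<phi> \<omega>" by simp
  qed
  from this have "emeasure M {\<omega> \<in> space M. \<phi> \<omega> \<ge> ennreal (4 * c)} \<le> emeasure M {\<omega> \<in> space M. 1 \<le> ennreal (1 / (4 * c)) * \<phi> \<omega>}"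
    by (rule emeasure_mono) measurable
  then show ?thesis using le by (rule order_trans)
qed

text \<open>By Cameron-Martin the probability is the expectation of a density over the event that
  the unshifted growth is small. With probability at least 1/2 this event occurs and the linear
  functional \<open>X\<close> in the density is bounded, both uniformly in \<open>n\<close>.\<close>

lemma growth_shift_prob:
  obtains p :: real where "p > 0" "\<And>n. n > 0 \<Longrightarrow>
    prob {\<omega> \<in> space M. growth n (\<lambda>k. f k \<omega> - block_coeffs P n k) \<le> ennreal (80 * n powr (3/2))} \<ge> p"
proof -
  define H where "H = (\<Sum>i\<le>degree P. (cmod (coeff P i))\<^sup>2)"
  \<comment> \<open>Chosen so that the square of \<open>\<kappa>\<close> is at least 2H without a
    square root; \<open>\<kappa>\<close> then bounds the expected modulus of
    \<open>X\<close>.\<close>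
  define \<kappa> where "\<kappa> = 2 * H + 1"
  have H0: "H \<ge> 0" unfolding H_def by (intro sum_nonneg) auto
  have \<kappa>: "\<kappa> > 0" "2 * H \<le> \<kappa>\<^sup>2" using H0 by (auto simp: \<kappa>_def power2_eq_square algebra_simps)
  \<comment> \<open>If \<open>X\<close> has modulus at most 4\<kappa>, the density is at least exp
    (-8\<kappa> - H). The division by 2 accounts for the probability of the good event.\<close>
  define p where "p = exp (- 8 * \<kappa> - H) / 2"
  show ?thesis
  proof (rule that[of p])
    show "p > 0" by (simp add: p_def)
    fix n :: nat assume n: "n > 0"
    define h where "h = block_coeffs P n"
    define J where "J = {..<Suc (degree P) * n}"
    have hJ: "(\<Sum>k\<in>J. (cmod (h k))\<^sup>2) = H"
      unfolding J_def h_def H_def by (rule block_coeffs_sum_power2[OF n])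
    have h0: "h k = 0" if "k \<notin> J" for k
      using that block_coeffs_eq_0[OF n] by (auto simp: J_def h_def not_less)
    define A where "A x = (growth n x \<le> ennreal (80 * n powr (3/2)))" for x
    define X where "X x = (\<Sum>k\<in>J. cnj (h k) * x k)" for x :: "nat \<Rightarrow> complex"
    have [measurable]: "growth n \<in> borel_measurable (PiM UNIV (\<lambda>_. borel))"
      using growth_measurable[of "\<lambda>k x. x k" "PiM UNIV (\<lambda>_. borel)" n]
      by (simp add: measurable_component_singleton)
    have [measurable]: "Measurable.pred (PiM UNIV (\<lambda>_. borel)) A" unfolding A_def by measurable
    have [measurable]: "X \<in> borel_measurable (PiM UNIV (\<lambda>_. borel))" unfolding X_def by measurable
    have [measurable]: "(\<lambda>\<omega> k. f k \<omega>) \<in> M \<rightarrow>\<^sub>M PiM UNIV (\<lambda>_. borel)"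
      by (rule measurable_into_sequences) simp
    have [measurable]: "(\<lambda>\<omega> k. f k \<omega> - h k) \<in> M \<rightarrow>\<^sub>M PiM UNIV (\<lambda>_. borel)"
      by (rule measurable_into_sequences) simp
    \<comment> \<open>Markov's inequality at four times the expectation bound gives each bad event
      probability at most 1/4; this is where 80 = 4 * 20 comes from.\<close>
    define B1 where "B1 = {\<omega> \<in> space M. growth n (\<lambda>k. f k \<omega>) \<ge> ennreal (4 * (20 * n powr (3/2)))}"
    define B2 where "B2 = {\<omega> \<in> space M. ennreal (cmod (X (\<lambda>k. f k \<omega>))) \<ge> ennreal (4 * \<kappa>)}"
    have [measurable]: "B1 \<in> events" "B2 \<in> events" unfolding B1_def B2_def by measurable
    have "emeasure M B1 \<le> ennreal (1/4)"
      unfolding B1_def by (rule markov_prob) (use nn_integral_growth_le[OF n] n in auto)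
    moreover have "emeasure M B2 \<le> ennreal (1/4)"
      unfolding B2_def X_def by (rule markov_prob, measurable)
        (use nn_integral_norm_sum_le[of J \<kappa> "\<lambda>k. cnj (h k)"] \<kappa> hJ in \<open>auto simp: J_def\<close>)
    ultimately have "prob B1 \<le> 1/4" "prob B2 \<le> 1/4" by (simp_all add: emeasure_eq_measure)
    moreover have "prob (B1 \<union> B2) \<le> prob B1 + prob B2" by (rule measure_Un_le) auto
    ultimately have "prob (B1 \<union> B2) \<le> 1/2" by linarith
    then have good: "prob (space M - (B1 \<union> B2)) \<ge> 1/2" by (subst prob_compl) auto
    have "ennreal (prob {\<omega> \<in> space M. A (\<lambda>k. f k \<omega> - h k)}) = emeasure M {\<omega> \<in> space M. A (\<lambda>k. f k \<omega> - h k)}"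
      by (rule emeasure_eq_measure[symmetric])
    also have "\<dots> = (\<integral>\<^sup>+\<omega>. indicator {\<omega> \<in> space M. A (\<lambda>k. f k \<omega> - h k)} \<omega> \<partial>M)" by simp
    also have "\<dots> = (\<integral>\<^sup>+\<omega>. (\<lambda>x. indicator (Collect A) (\<lambda>k. if k \<in> J then x k - h k else x k)) (\<lambda>k. f k \<omega>) \<partial>M)"
    proof (intro nn_integral_cong)
      fix \<omega> assume "\<omega> \<in> space M"
      have "(\<lambda>k. f k \<omega> - h k) = (\<lambda>k. if k \<in> J then f k \<omega> - h k else f k \<omega>)" using h0 by auto
      then show "(indicator {\<omega> \<in> space M. A (\<lambda>k. f k \<omega> - h k)} \<omega> :: ennreal) =
         indicator (Collect A) (\<lambda>k. if k \<in> J then f k \<omega> - h k else f k \<omega>)"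
        using \<open>\<omega> \<in> space M\<close> by (simp add: indicator_def)
    qed
    also have "\<dots> = (\<integral>\<^sup>+x. indicator (Collect A) (\<lambda>k. if k \<in> J then x k - h k else x k) \<partial>gauss_seq)"
    proof (rule nn_integral_gauss_seq[symmetric])
      have [measurable]: "(\<lambda>x k. if k \<in> J then x k - h k else x k) \<in> PiM UNIV (\<lambda>_. borel) \<rightarrow>\<^sub>M PiM UNIV (\<lambda>_. borel)"
        by (rule measurable_into_sequences) (auto intro!: measurable_component_singleton borel_measurable_diff)
      show "(\<lambda>x. indicator (Collect A) (\<lambda>k. if k \<in> J then x k - h k else x k) :: ennreal) \<in> borel_measurable (PiM UNIV (\<lambda>_. borel))"
        by measurable
    qed
    also have "\<dots> = (\<integral>\<^sup>+x. indicator (Collect A) x * (\<Prod>k\<in>J. ennreal (exp (- 2 * Re (cnj (h k) * x k) - (cmod (h k))\<^sup>2))) \<partial>gauss_seq)"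
      by (rule nn_integral_gauss_seq_shift[OF prob_space_gauss_measure]) (auto simp: J_def)
    also have "\<dots> = (\<integral>\<^sup>+\<omega>. indicator (Collect A) (\<lambda>k. f k \<omega>) *
        (\<Prod>k\<in>J. ennreal (exp (- 2 * Re (cnj (h k) * f k \<omega>) - (cmod (h k))\<^sup>2))) \<partial>M)"
      by (rule nn_integral_gauss_seq) measurable
    also have "\<dots> \<ge> (\<integral>\<^sup>+\<omega>. ennreal (exp (- 8 * \<kappa> - H)) * indicator (space M - (B1 \<union> B2)) \<omega> \<partial>M)"
    proof (intro nn_integral_mono)
      fix \<omega> assume \<omega>: "\<omega> \<in> space M"
      show "ennreal (exp (- 8 * \<kappa> - H)) * indicator (space M - (B1 \<union> B2)) \<omega> \<le> indicator (Collect A) (\<lambda>k. f k \<omega>) *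
        (\<Prod>k\<in>J. ennreal (exp (- 2 * Re (cnj (h k) * f k \<omega>) - (cmod (h k))\<^sup>2)))"
      proof (cases "\<omega> \<in> B1 \<union> B2")
        case False
        then have A: "A (\<lambda>k. f k \<omega>)" and X4: "cmod (X (\<lambda>k. f k \<omega>)) \<le> 4 * \<kappa>"
          using \<omega> \<kappa> by (auto simp: A_def B1_def B2_def ennreal_le_iff not_le)
        have "(\<Prod>k\<in>J. ennreal (exp (- 2 * Re (cnj (h k) * f k \<omega>) - (cmod (h k))\<^sup>2))) =
           ennreal (exp (\<Sum>k\<in>J. - 2 * Re (cnj (h k) * f k \<omega>) - (cmod (h k))\<^sup>2))"
          by (subst prod_ennreal) (auto simp: exp_sum J_def)
        also have "(\<Sum>k\<in>J. - 2 * Re (cnj (h k) * f k \<omega>) - (cmod (h k))\<^sup>2) = - 2 * Re (X (\<lambda>k. f k \<omega>)) - H"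
          unfolding X_def Re_sum hJ[symmetric] by (simp only: sum_subtractf sum_distrib_left)
        finally have e: "(\<Prod>k\<in>J. ennreal (exp (- 2 * Re (cnj (h k) * f k \<omega>) - (cmod (h k))\<^sup>2))) =
            ennreal (exp (- 2 * Re (X (\<lambda>k. f k \<omega>)) - H))" .
        have "Re (X (\<lambda>k. f k \<omega>)) \<le> 4 * \<kappa>" using X4 complex_Re_le_cmod order_trans by blast
        then have "exp (- 8 * \<kappa> - H) \<le> exp (- 2 * Re (X (\<lambda>k. f k \<omega>)) - H)" by simp
        then show ?thesis unfolding e using A False \<omega> by (simp add: ennreal_leI)
      qed simp
    qed
    also (xtrans) have "(\<integral>\<^sup>+\<omega>. ennreal (exp (- 8 * \<kappa> - H)) * indicator (space M - (B1 \<union> B2)) \<omega> \<partial>M) =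
       ennreal (exp (- 8 * \<kappa> - H) * prob (space M - (B1 \<union> B2)))"
      by (subst nn_integral_cmult_indicator) (auto simp: emeasure_eq_measure ennreal_mult)
    also (xtrans) have "\<dots> \<ge> ennreal p"
    proof (rule ennreal_leI)
      show "p \<le> exp (- 8 * \<kappa> - H) * prob (space M - (B1 \<union> B2))"
        unfolding p_def using mult_left_mono[OF good, of "exp (- 8 * \<kappa> - H)"] by simp
    qed
    finally (xtrans) show "p \<le> prob {\<omega> \<in> space M. growth n (\<lambda>k. f k \<omega> - block_coeffs P n k) \<le> ennreal (80 * n powr (3/2))}"
      by (simp add: A_def h_def ennreal_le_iff)
  qed
qed

end

subsection \<open>Almost sure clustering\<close>

text \<open>Changing the first \<open>m\<close> coefficients moves every partial sum by at most the
  sum of the changes, and the geometric weights have total mass at most 4n.\<close>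

lemma growth_perturb:
  assumes n: "n > 0" and eq: "\<And>k. k \<ge> m \<Longrightarrow> x k = y k"
  shows "growth n x \<le> growth n y + ennreal (4 * (\<Sum>k<m. cmod (x k - y k)) * n)"
proof -
  define D where "D = (\<Sum>k<m. cmod (x k - y k))"
  define q where "q = exp (- 1 / (2 * real n))"
  have D: "D \<ge> 0" unfolding D_def by (intro sum_nonneg) auto
  have q: "0 < q" "q < 1" using n by (auto simp: q_def)
  have le: "cmod (\<Sum>k\<le>j. x k) \<le> cmod (\<Sum>k\<le>j. y k) + D" for j
  proof -
    have "cmod ((\<Sum>k\<le>j. x k) - (\<Sum>k\<le>j. y k)) \<le> (\<Sum>k\<le>j. cmod (x k - y k))"
      unfolding sum_subtractf[symmetric] by (rule norm_sum)
    also have "\<dots> = (\<Sum>k\<in>{..j} \<inter> {..<m}. cmod (x k - y k))"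
      by (rule sum.mono_neutral_right) (auto simp: eq not_less)
    also have "\<dots> \<le> D" unfolding D_def by (rule sum_mono2) auto
    finally show ?thesis using norm_triangle_ineq2[of "\<Sum>k\<le>j. x k" "\<Sum>k\<le>j. y k"] by linarith
  qed
  have "growth n x \<le> (\<Sum>j. ennreal (cmod (\<Sum>k\<le>j. y k) * q ^ j) + ennreal (D * q ^ j))"
    unfolding growth_def q_def[symmetric]
  proof (intro suminf_le)
    fix j
    have "cmod (\<Sum>k\<le>j. x k) * q ^ j \<le> cmod (\<Sum>k\<le>j. y k) * q ^ j + D * q ^ j"
      using mult_right_mono[OF le[of j], of "q ^ j"] q by (simp add: distrib_right)
    then show "ennreal (cmod (\<Sum>k\<le>j. x k) * q ^ j) \<le> ennreal (cmod (\<Sum>k\<le>j. y k) * q ^ j) + ennreal (D * q ^ j)"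
      using q D by (simp add: ennreal_leI flip: ennreal_plus)
  qed auto
  also have "\<dots> = growth n y + (\<Sum>j. ennreal (D * q ^ j))"
    unfolding growth_def q_def[symmetric] by (rule suminf_add[symmetric]) auto
  also have "(\<Sum>j. ennreal (D * q ^ j)) = ennreal (D * (1 / (1 - q)))"
  proof -
    have s: "(\<lambda>j. D * q ^ j) sums (D * (1 / (1 - q)))" using q by (intro sums_mult geometric_sums) auto
    show ?thesis using sums_unique[OF s] sums_summable[OF s] q D by (subst suminf_ennreal2) auto
  qed
  also have "ennreal (D * (1 / (1 - q))) \<le> ennreal (4 * D * n)"
  proof (rule ennreal_leI)
    have "1 / (4 * real n) \<le> 1 - q" using one_minus_exp_ge[of "1 / (2 * real n)"] n by (simp add: q_def)
    then have "1 / (1 - q) \<le> 4 * real n" using q n by (simp add: field_simps)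
    from mult_left_mono[OF this D] show "D * (1 / (1 - q)) \<le> 4 * D * n" by (simp add: mult_ac)
  qed
  finally show ?thesis by (simp add: D_def add_left_mono)
qed

text \<open>The condition says in countable form that the lower limit of b n / n^(3/2) is at most c.
  A linear error does not affect it: the index 2l + 1 halves the slack 1/(l + 1), and the other half
  absorbs D n.\<close>

lemma small_growth_perturb:
  fixes a b :: "nat \<Rightarrow> ennreal" and c D :: real
  assumes c: "c \<ge> 0" and D: "D \<ge> 0"
    and b: "\<forall>l N. \<exists>n\<ge>N. b n < ennreal ((c + 1 / real (Suc l)) * n powr (3/2))"
    and ab: "\<And>n. n > 0 \<Longrightarrow> a n \<le> b n + ennreal (D * n)"
  shows "\<forall>l N. \<exists>n\<ge>N. a n < ennreal ((c + 1 / real (Suc l)) * n powr (3/2))"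
proof (intro allI)
  fix l N :: nat
  \<comment> \<open>Once sqrt n is at least K, the error D n is at most n^(3/2) / (2l + 2).\<close>
  define K where "K = 2 * D * real (Suc l)"
  obtain N' where N': "K\<^sup>2 < real N'" using reals_Archimedean2 by blast
  obtain n where n: "n \<ge> max N (max N' 1)" and bn: "b n < ennreal ((c + 1 / real (Suc (2 * l + 1))) * n powr (3/2))"
    using b by blast
  have n0: "n > 0" using n by simp
  have K: "K \<ge> 0" using D by (simp add: K_def)
  have "K\<^sup>2 \<le> real n" using N' n by linarith
  then have "K \<le> sqrt n" using K real_le_rsqrt by blast
  then have "K * n \<le> sqrt n * n" by (intro mult_right_mono) auto
  also have "\<dots> = n powr (3/2)" using n0 by (simp add: powr_half_sqrt[symmetric] powr_mult_base mult.commute)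
  finally have Dn: "D * n \<le> 1 / real (Suc (2 * l + 1)) * n powr (3/2)"
    by (simp add: K_def field_simps)
  have "a n \<le> b n + ennreal (D * n)" using ab[OF n0] .
  also have "\<dots> < ennreal ((c + 1 / real (Suc (2 * l + 1))) * n powr (3/2)) + ennreal (D * n)"
    using bn by (simp add: add_less_cancel_left ennreal_add_left_cancel_less add.commute)
  also have "\<dots> = ennreal ((c + 1 / real (Suc (2 * l + 1))) * n powr (3/2) + D * n)"
    using c D by (subst ennreal_plus) auto
  also have "\<dots> \<le> ennreal ((c + 1 / real (Suc l)) * n powr (3/2))"
  proof (rule ennreal_leI)
    have "1 / real (Suc l) = 1 / real (Suc (2 * l + 1)) + 1 / real (Suc (2 * l + 1))"
      by (simp add: field_simps)
    then show "(c + 1 / real (Suc (2 * l + 1))) * n powr (3/2) + D * n \<le> (c + 1 / real (Suc l)) * n powr (3/2)"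
      using Dn by (simp only: distrib_right)
  qed
  finally show "\<exists>n\<ge>N. a n < ennreal ((c + 1 / real (Suc l)) * n powr (3/2))"
    using n by auto
qed

text \<open>The bound is uniform in \<open>n\<close>, so deleting the first \<open>m\<close> terms
  costs a multiple of \<open>n\<close> whose constant is the same at all scales.\<close>

lemma norm_block_coeffs_le:
  assumes n: "n > 0"
  shows "cmod (block_coeffs P n k) \<le> (\<Sum>i\<le>degree P. cmod (coeff P i))"
proof -
  have "cmod (block_coeffs P n k) = cmod (coeff P (k div n)) / sqrt n"
    using n by (simp add: block_coeffs_def norm_divide)
  also have "\<dots> \<le> cmod (coeff P (k div n)) / 1" using n by (intro divide_left_mono) auto
  also have "\<dots> \<le> (\<Sum>i\<le>degree P. cmod (coeff P i))"
  proof (cases "k div n \<le> degree P")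
    case True
    then show ?thesis using member_le_sum[of "k div n" "{..degree P}" "\<lambda>i. cmod (coeff P i)"] by simp
  next
    case False
    then show ?thesis by (simp add: coeff_eq_0 sum_nonneg)
  qed
  finally show ?thesis .
qed

context gaussian_sequence
begin

text \<open>Each scale is good with probability at least p, so infinitely many are good with
  probability at least p. This event implies the tail event \<open>E 0\<close>, which therefore has
  probability 1.\<close>

lemma AE_small_growth:
  "AE \<omega> in M. \<exists>n>0. growth n (\<lambda>k. f k \<omega> - block_coeffs P n k) \<le> ennreal (81 * n powr (3/2))"
proof -
  define h where "h = block_coeffs P"
  define small where "small x \<longleftrightarrow> (\<forall>l N. \<exists>n\<ge>N. growth n (x n) < ennreal ((80 + 1 / real (Suc l)) * n powr (3/2)))"
    for x :: "nat \<Rightarrow> nat \<Rightarrow> complex"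
  define E where "E m = {\<omega> \<in> space M. small (\<lambda>n k. if k < m then 0 else f k \<omega> - h n k)}" for m
  \<comment> \<open>Changing finitely many coefficients changes the growth at scale \<open>n\<close> by \<open>O(n)\<close>, which is
    negligible against \<open>n\<^sup>3\<^sup>/\<^sup>2\<close>; the slack \<open>1 / (l + 1)\<close> absorbs it.\<close>
  have E_eq: "E m = E 0" for m
  proof -
    have "small (\<lambda>n k. if k < m then 0 else f k \<omega> - h n k) \<longleftrightarrow> small (\<lambda>n k. f k \<omega> - h n k)" for \<omega>
    proof -
      define B where "B = (\<Sum>i\<le>degree P. cmod (coeff P i))"
      define D where "D = 4 * (\<Sum>k<m. cmod (f k \<omega>) + B)"
      have B: "B \<ge> 0" unfolding B_def by (intro sum_nonneg) auto
      have D: "D \<ge> 0" unfolding D_def using B by (intro mult_nonneg_nonneg sum_nonneg add_nonneg_nonneg) auto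
      have Dle: "ennreal (4 * (\<Sum>k<m. cmod (u k)) * n) \<le> ennreal (D * n)"
        if "n > 0" "\<And>k. k < m \<Longrightarrow> cmod (u k) = cmod (f k \<omega> - h n k)" for n and u :: "nat \<Rightarrow> complex"
      proof (rule ennreal_leI)
        have "cmod (u k) \<le> cmod (f k \<omega>) + B" if "k < m" for k
          using that norm_triangle_ineq4[of "f k \<omega>" "h n k"] norm_block_coeffs_le[OF \<open>n > 0\<close>, of P k]
            \<open>\<And>k. k < m \<Longrightarrow> cmod (u k) = cmod (f k \<omega> - h n k)\<close>[of k] by (simp add: h_def B_def)
        then have "(\<Sum>k<m. cmod (u k)) \<le> (\<Sum>k<m. cmod (f k \<omega>) + B)" by (intro sum_mono) auto
        then show "4 * (\<Sum>k<m. cmod (u k)) * n \<le> D * n" unfolding D_def by (intro mult_right_mono) auto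
      qed
      have 1: "growth n (\<lambda>k. if k < m then 0 else f k \<omega> - h n k) \<le> growth n (\<lambda>k. f k \<omega> - h n k) + ennreal (D * n)"
        if "n > 0" for n
        by (rule order_trans[OF growth_perturb[OF that, of m] add_left_mono[OF Dle[OF that]]])
          (auto simp: norm_minus_commute)
      have 2: "growth n (\<lambda>k. f k \<omega> - h n k) \<le> growth n (\<lambda>k. if k < m then 0 else f k \<omega> - h n k) + ennreal (D * n)"
        if "n > 0" for n
        by (rule order_trans[OF growth_perturb[OF that, of m] add_left_mono[OF Dle[OF that]]]) auto
      show ?thesis
      proof
        assume a: "small (\<lambda>n k. if k < m then 0 else f k \<omega> - h n k)"
        show "small (\<lambda>n k. f k \<omega> - h n k)"
          unfolding small_def by (rule small_growth_perturb[OF _ D a[unfolded small_def] 2]) simp_all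
      next
        assume a: "small (\<lambda>n k. f k \<omega> - h n k)"
        show "small (\<lambda>n k. if k < m then 0 else f k \<omega> - h n k)"
          unfolding small_def by (rule small_growth_perturb[OF _ D a[unfolded small_def] 1]) simp_all
      qed
    qed
    then show ?thesis by (simp add: E_def)
  qed
  define \<A> where "\<A> k = sigma_sets (space M) {f k -` A \<inter> space M | A. A \<in> sets borel}" for k
  \<comment> \<open>\<open>E m\<close> involves the variables of index at least \<open>m\<close>,
    and it equals \<open>E 0\<close> for every \<open>m\<close>.\<close>
  have tail: "E 0 \<in> tail_events \<A>"
    unfolding tail_events_def
  proof
    fix m :: nat
    define G where "G = \<Union> (\<A> ` {m..})"
    have sub: "\<A> k \<subseteq> Pow (space M)" for k
      unfolding \<A>_def using sigma_sets_into_sp[of "{f k -` A \<inter> space M | A. A \<in> sets borel}" "space M"] by blast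
    then have GP: "G \<subseteq> Pow (space M)" unfolding G_def by blast
    define N where "N = sigma (space M) G"
    have sN: "space N = space M" "sets N = sigma_sets (space M) G"
      using GP by (simp_all add: N_def)
    have f[measurable]: "f k \<in> borel_measurable N" if "k \<ge> m" for k
    proof (rule measurableI)
      fix A :: "complex set" assume "A \<in> sets borel"
      then have "f k -` A \<inter> space M \<in> \<A> k" unfolding \<A>_def by (intro sigma_sets.Basic) blast
      then show "f k -` A \<inter> space N \<in> sets N"
        unfolding sN G_def using that by (intro sigma_sets.Basic) auto
    qed auto
    have [measurable]: "(\<lambda>\<omega>. growth n (\<lambda>k. if k < m then 0 else f k \<omega> - h n k)) \<in> borel_measurable N" for n
    proof (rule growth_measurable)
      fix k show "(\<lambda>\<omega>. if k < m then 0 else f k \<omega> - h n k) \<in> borel_measurable N"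
        using f[of k] by (cases "k < m") auto
    qed
    have "{\<omega> \<in> space N. small (\<lambda>n k. if k < m then 0 else f k \<omega> - h n k)} \<in> sets N"
      unfolding small_def by measurable
    then have "E m \<in> sigma_sets (space M) G" by (simp add: E_def sN)
    then show "E 0 \<in> sigma_sets (space M) (\<Union> (\<A> ` {m..}))" using E_eq[of m] by (simp only: G_def)
  qed
  have ind: "indep_sets \<A> UNIV" using indep unfolding indep_vars_def \<A>_def by simp
  have sa: "sigma_algebra (space M) (\<A> k)" for k
    unfolding \<A>_def by (rule sigma_algebra_sigma_sets) auto
  have zo: "prob (E 0) = 0 \<or> prob (E 0) = 1" by (rule kolmogorov_0_1_law[OF sa ind tail])
  have Emeas: "E 0 \<in> events"
    using tail_events_sets[of \<A>] tail ind unfolding indep_sets_def by blast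
  obtain p :: real where p: "p > 0" "\<And>n. n > 0 \<Longrightarrow>
    prob {\<omega> \<in> space M. growth n (\<lambda>k. f k \<omega> - h n k) \<le> ennreal (80 * n powr (3/2))} \<ge> p"
    using growth_shift_prob[of P] unfolding h_def by blast
  define good where "good n = {\<omega> \<in> space M. growth n (\<lambda>k. f k \<omega> - h n k) \<le> ennreal (80 * n powr (3/2))}" for n
  have [measurable]: "(\<lambda>\<omega>. growth n (\<lambda>k. f k \<omega> - h n k)) \<in> borel_measurable M" for n
    by (rule growth_measurable) measurable
  have [measurable]: "good n \<in> events" for n unfolding good_def by measurable
  \<comment> \<open>Some scale beyond \<open>N\<close> is good. These events decrease, so continuity
    from above gives their intersection probability at least p; starting at \<open>Suc N\<close>
    keeps \<open>n\<close> positive.\<close>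
  define S where "S N = (\<Union>n\<in>{Suc N..}. good n)" for N
  have S: "range S \<subseteq> events" "decseq S"
    unfolding S_def decseq_def by auto (meson Suc_le_mono atLeast_iff order_trans)
  have "p \<le> prob (\<Inter>N. S N)"
  proof (rule LIMSEQ_le_const[OF finite_Lim_measure_decseq[OF S]], intro exI allI impI)
    fix N :: nat
    have "p \<le> prob (good (Suc N))" using p(2)[of "Suc N"] by (simp add: good_def)
    also have "\<dots> \<le> prob (S N)" using S(1) by (intro finite_measure_mono) (auto simp: S_def)
    finally show "p \<le> prob (S N)" .
  qed
  also have "\<dots> \<le> prob (E 0)"
  proof (rule finite_measure_mono[OF _ Emeas], rule subsetI)
    fix \<omega> assume \<omega>: "\<omega> \<in> (\<Inter>N. S N)"
    have "small (\<lambda>n k. f k \<omega> - h n k)" unfolding small_def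
    proof (intro allI)
      fix l N :: nat
      obtain n where n: "n \<ge> Suc N" "\<omega> \<in> good n" using \<omega> by (auto simp: S_def)
      then have "growth n (\<lambda>k. f k \<omega> - h n k) \<le> ennreal (80 * n powr (3/2))" by (simp add: good_def)
      also have "\<dots> < ennreal ((80 + 1 / real (Suc l)) * n powr (3/2))"
        using n by (intro ennreal_lessI mult_strict_right_mono mult_pos_pos add_pos_nonneg) auto
      finally show "\<exists>n\<ge>N. growth n (\<lambda>k. f k \<omega> - h n k) < ennreal ((80 + 1 / real (Suc l)) * n powr (3/2))"
        using n(1) by (intro exI[of _ n]) auto
    qed
    moreover have "\<omega> \<in> space M" using \<omega> by (auto simp: S_def good_def)
    ultimately show "\<omega> \<in> E 0" by (simp add: E_def)
  qed
  finally have "prob (E 0) = 1" using zo p(1) by linarith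
  then have "AE \<omega> in M. \<omega> \<in> E 0" using Emeas by (simp add: prob_eq_1)
  then show ?thesis
  proof (rule AE_mp, intro AE_I2 impI)
    fix \<omega> assume "\<omega> \<in> E 0"
    then have "small (\<lambda>n k. f k \<omega> - h n k)" by (simp add: E_def)
    \<comment> \<open>The instance l = 0, N = 1 gives the constant 80 + 1 = 81 and a positive
      \<open>n\<close>.\<close>
    then obtain n where n: "n \<ge> 1" "growth n (\<lambda>k. f k \<omega> - h n k) < ennreal ((80 + 1 / real (Suc 0)) * n powr (3/2))"
      unfolding small_def by blast
    then show "\<exists>n>0. growth n (\<lambda>k. f k \<omega> - block_coeffs P n k) \<le> ennreal (81 * n powr (3/2))"
      by (intro exI[of _ n]) (auto simp: h_def)
  qed
qed

text \<open>Each \<open>N\<close> has its own deterministic polynomial, and the countably many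
  almost sure events are intersected.\<close>

lemma AE_clustered: "AE \<omega> in M. clustered (gaf_zeros (\<lambda>n. f n \<omega>))"
proof -
  have "AE \<omega> in M. N > 0 \<longrightarrow> (\<exists>\<rho>\<in>{0<..<1}. \<exists>S. finite S \<and> card S = N \<and>
     S \<subseteq> gaf_zeros (\<lambda>n. f n \<omega>) \<inter> ball (of_real \<rho>) ((1 - \<rho>) / N))" for N :: nat
  proof (cases "N > 0")
    case True
    obtain P where P: "\<And>M x. M > 0 \<Longrightarrow> growth M (\<lambda>k. x k - block_coeffs P M k) \<le> ennreal (81 * M powr (3/2)) \<Longrightarrow>
     \<exists>\<rho>\<in>{0<..<1}. \<exists>S. finite S \<and> card S = N \<and> S \<subseteq> gaf_zeros x \<inter> ball (of_real \<rho>) ((1 - \<rho>) / N)"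
      using cluster_polynomial[OF True, of 81] by auto
    show ?thesis
      using AE_small_growth[of P]
    proof eventually_elim
      case (elim \<omega>)
      then show ?case using P[of _ "\<lambda>k. f k \<omega>"] by blast
    qed
  qed simp
  then show ?thesis unfolding clustered_def by (simp add: AE_all_countable)
qed

end

theorem proposition1p3:
  fixes M :: "'a measure" and f :: "nat \<Rightarrow> 'a \<Rightarrow> complex"
  assumes "prob_space M"
    and "prob_space.indep_vars M (\<lambda>_. borel) f UNIV"
    and "\<And>n. std_complex_gaussian M (f n)"
  shows "AE \<omega> in M. \<not> bergman_sampling (gaf_zeros (\<lambda>n. f n \<omega>)) \<and>
                     \<not> bergman_interpolating (gaf_zeros (\<lambda>n. f n \<omega>))"
proof -
  interpret gaussian_sequence M f
    using assms by (intro gaussian_sequence.intro gaussian_sequence_axioms.intro) auto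
  show ?thesis
    using AE_clustered
    by eventually_elim (simp add: not_bergman_sampling not_bergman_interpolating)
qed

end
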